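(* Let $R$ be a weakly $2$-primal generalized $t$-fine ring. Then, for every positive integer $n$, the matrix ring $\mathbb{M}_n(R)$ is also generalized $t$-fine.
   Context: Rings are associative with identity $1$ (not necessarily commutative). For a ring $R$: $\mathrm{J}(R)$ is the Jacobson radical, $\mathrm{Nil}(R)$ the set of nilpotent elements, and $\mathcal{T}(R)$ the set of torsion units, i.e. units $u$ with $u^m=1$ for some $m\ge 1$. $R$ is generalized $t$-fine if $R\setminus \mathrm{J}(R)=\mathcal{T}(R)+\mathrm{Nil}(R)$. $R$ is weakly $2$-primal if $\mathrm{Nil}(R)$ coincides with the Levitzki radical (the largest locally nilpotent ideal) of $R$. $\mathbb{M}_n(R)$ is the ring of $n\times n$ matrices over $R$. *)

theory Defs
  imports "Jordan_Normal_Form.Matrix" "HOL-Algebra.Ideal"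
begin

text \<open>Rings are those of HOL-Algebra: associative with identity, not necessarily commutative.
  The predicate \<^const>\<open>ideal\<close> means two-sided ideal.\<close>

hide_const (open) Multiset.mult

definition left_ideal :: "'a set \<Rightarrow> ('a, 'm) ring_scheme \<Rightarrow> bool" where
  "left_ideal I R \<longleftrightarrow> additive_subgroup I R \<and> (\<forall>a\<in>carrier R. \<forall>x\<in>I. a \<otimes>\<^bsub>R\<^esub> x \<in> I)"

definition maximal_left_ideal :: "'a set \<Rightarrow> ('a, 'm) ring_scheme \<Rightarrow> bool" where
  "maximal_left_ideal I R \<longleftrightarrow> left_ideal I R \<and> I \<noteq> carrier R \<and>
     (\<forall>K. left_ideal K R \<and> I \<subseteq> K \<longrightarrow> K = I \<or> K = carrier R)"

text \<open>Intersecting with the carrier only matters for the zero ring, which has no maximal left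
  ideals and is its own radical.\<close>

definition jacobson_radical :: "('a, 'm) ring_scheme \<Rightarrow> 'a set" where
  "jacobson_radical R = carrier R \<inter> \<Inter> {I. maximal_left_ideal I R}"

definition nilpotents :: "('a, 'm) ring_scheme \<Rightarrow> 'a set" where
  "nilpotents R = {x \<in> carrier R. \<exists>k::nat. x [^]\<^bsub>R\<^esub> k = \<zero>\<^bsub>R\<^esub>}"

definition torsion_units :: "('a, 'm) ring_scheme \<Rightarrow> 'a set" where
  "torsion_units R = {u \<in> Units R. \<exists>m::nat. m \<ge> 1 \<and> u [^]\<^bsub>R\<^esub> m = \<one>\<^bsub>R\<^esub>}"

definition generalized_t_fine :: "('a, 'm) ring_scheme \<Rightarrow> bool" where
  "generalized_t_fine R \<longleftrightarrow>
     carrier R - jacobson_radical R = torsion_units R <+>\<^bsub>R\<^esub> nilpotents R"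

text \<open>A set is locally nilpotent if for each of its finite subsets \<open>F\<close> all sufficiently long
  products of elements of \<open>F\<close> vanish, i.e. the non-unital subring generated by \<open>F\<close> is
  nilpotent.\<close>

definition locally_nilpotent :: "'a set \<Rightarrow> ('a, 'm) ring_scheme \<Rightarrow> bool" where
  "locally_nilpotent S R \<longleftrightarrow>
     (\<forall>F. finite F \<and> F \<subseteq> S \<longrightarrow>
        (\<exists>N. \<forall>xs. set xs \<subseteq> F \<and> length xs = N \<longrightarrow> foldr (\<otimes>\<^bsub>R\<^esub>) xs \<one>\<^bsub>R\<^esub> = \<zero>\<^bsub>R\<^esub>))"

text \<open>The Levitzki radical is the largest locally nilpotent ideal; it is described here by the
  predicate ``\<open>L\<close> is the Levitzki radical of \<open>R\<close>''.\<close>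

definition levitzki_radical :: "'a set \<Rightarrow> ('a, 'm) ring_scheme \<Rightarrow> bool" where
  "levitzki_radical L R \<longleftrightarrow> ideal L R \<and> locally_nilpotent L R \<and>
     (\<forall>I. ideal I R \<and> locally_nilpotent I R \<longrightarrow> I \<subseteq> L)"

lemma levitzki_radical_unique:
  "levitzki_radical L R \<Longrightarrow> levitzki_radical L' R \<Longrightarrow> L = L'"
  by (auto simp: levitzki_radical_def)

definition weakly_2_primal :: "('a, 'm) ring_scheme \<Rightarrow> bool" where
  "weakly_2_primal R \<longleftrightarrow> levitzki_radical (nilpotents R) R"

text \<open>The library's \<open>ring_mat\<close> takes its entries from a type of class \<open>semiring_1\<close>. Here the
  entries come from an arbitrary HOL-Algebra ring; as the element type carries no class
  structure, the operations are spelled out entrywise. Indices start at 0.\<close>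

definition matrix_ring :: "nat \<Rightarrow> ('a, 'm) ring_scheme \<Rightarrow> 'a mat ring" where
  "matrix_ring n R =
     \<lparr>carrier = {A \<in> carrier_mat n n. \<forall>i<n. \<forall>j<n. A $$ (i, j) \<in> carrier R},
      mult = (\<lambda>A B. mat n n (\<lambda>(i, j). \<Oplus>\<^bsub>R\<^esub>k\<in>{..<n}. A $$ (i, k) \<otimes>\<^bsub>R\<^esub> B $$ (k, j))),
      one = mat n n (\<lambda>(i, j). if i = j then \<one>\<^bsub>R\<^esub> else \<zero>\<^bsub>R\<^esub>),
      zero = mat n n (\<lambda>(i, j). \<zero>\<^bsub>R\<^esub>),
      add = (\<lambda>A B. mat n n (\<lambda>(i, j). A $$ (i, j) \<oplus>\<^bsub>R\<^esub> B $$ (i, j)))\<rparr>"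

lemma matrix_ring_is_ring:
  fixes R (structure)
  assumes "ring R"
  shows "ring (matrix_ring n R)"
proof -
  interpret ring R by fact
  let ?M = "matrix_ring n R"
  note M = matrix_ring_def
  show ?thesis
  proof (rule ringI)
    show "abelian_group ?M"
    proof (rule abelian_groupI)
      fix A assume A: "A \<in> carrier ?M"
      have "mat n n (\<lambda>(i, j). \<ominus> A $$ (i, j)) \<in> carrier ?M"
        using A by (auto simp: M)
      moreover have "mat n n (\<lambda>(i, j). \<ominus> A $$ (i, j)) \<oplus>\<^bsub>?M\<^esub> A = \<zero>\<^bsub>?M\<^esub>"
        using A by (intro eq_matI) (auto simp: M l_neg)
      ultimately show "\<exists>B\<in>carrier ?M. B \<oplus>\<^bsub>?M\<^esub> A = \<zero>\<^bsub>?M\<^esub>" by blast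
    qed (auto simp: M a_ac intro!: eq_matI)
    show "monoid ?M"
    proof (rule monoidI)
      fix A B assume "A \<in> carrier ?M" "B \<in> carrier ?M"
      then show "A \<otimes>\<^bsub>?M\<^esub> B \<in> carrier ?M"
        by (auto simp: M intro!: finsum_closed)
    next
      show "\<one>\<^bsub>?M\<^esub> \<in> carrier ?M" by (auto simp: M)
    next
      fix A B C assume ABC: "A \<in> carrier ?M" "B \<in> carrier ?M" "C \<in> carrier ?M"
      show "A \<otimes>\<^bsub>?M\<^esub> B \<otimes>\<^bsub>?M\<^esub> C = A \<otimes>\<^bsub>?M\<^esub> (B \<otimes>\<^bsub>?M\<^esub> C)"
      proof (rule eq_matI)
        fix i j
        assume "i < dim_row (A \<otimes>\<^bsub>?M\<^esub> (B \<otimes>\<^bsub>?M\<^esub> C))" "j < dim_col (A \<otimes>\<^bsub>?M\<^esub> (B \<otimes>\<^bsub>?M\<^esub> C))"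
        then have ij: "i < n" "j < n" by (auto simp: M)
        have cl: "A $$ (k, l) \<in> carrier R" "B $$ (k, l) \<in> carrier R" "C $$ (k, l) \<in> carrier R"
          if "k < n" "l < n" for k l using ABC that by (auto simp: M)
        have "(A \<otimes>\<^bsub>?M\<^esub> B \<otimes>\<^bsub>?M\<^esub> C) $$ (i, j) =
          (\<Oplus>k\<in>{..<n}. (\<Oplus>l\<in>{..<n}. A $$ (i, l) \<otimes> B $$ (l, k)) \<otimes> C $$ (k, j))"
          using ij cl by (auto simp: M intro!: finsum_cong' finsum_closed)
        also have "\<dots> = (\<Oplus>k\<in>{..<n}. \<Oplus>l\<in>{..<n}. A $$ (i, l) \<otimes> (B $$ (l, k) \<otimes> C $$ (k, j)))"
          using ij cl
          by (intro finsum_cong') (auto simp: finsum_ldistr m_assoc intro!: finsum_cong' finsum_closed)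
        also have "\<dots> = (\<Oplus>l\<in>{..<n}. \<Oplus>k\<in>{..<n}. A $$ (i, l) \<otimes> (B $$ (l, k) \<otimes> C $$ (k, j)))"
          using ij cl by (intro finsum_finsum_swap) auto
        also have "\<dots> = (\<Oplus>l\<in>{..<n}. A $$ (i, l) \<otimes> (\<Oplus>k\<in>{..<n}. B $$ (l, k) \<otimes> C $$ (k, j)))"
          using ij cl
          by (intro finsum_cong') (auto simp: finsum_rdistr intro!: finsum_cong' finsum_closed)
        also have "\<dots> = (A \<otimes>\<^bsub>?M\<^esub> (B \<otimes>\<^bsub>?M\<^esub> C)) $$ (i, j)"
          using ij cl by (auto simp: M intro!: finsum_cong' finsum_closed)
        finally show "(A \<otimes>\<^bsub>?M\<^esub> B \<otimes>\<^bsub>?M\<^esub> C) $$ (i, j) = (A \<otimes>\<^bsub>?M\<^esub> (B \<otimes>\<^bsub>?M\<^esub> C)) $$ (i, j)" .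
      qed (auto simp: M)
    next
      fix A assume A: "A \<in> carrier ?M"
      then have cl: "A $$ (k, l) \<in> carrier R" if "k < n" "l < n" for k l
        using that by (auto simp: M)
      have l: "(\<Oplus>k\<in>{..<n}. (if i = k then \<one> else \<zero>) \<otimes> A $$ (k, j)) = A $$ (i, j)"
        if "i < n" "j < n" for i j
      proof -
        have "(\<Oplus>k\<in>{..<n}. (if i = k then \<one> else \<zero>) \<otimes> A $$ (k, j)) =
          (\<Oplus>k\<in>{..<n}. if i = k then A $$ (k, j) else \<zero>)"
          using that cl by (intro finsum_cong') auto
        also have "\<dots> = A $$ (i, j)"
          using that cl by (intro add.finprod_singleton) auto
        finally show ?thesis .
      qed
      have r: "(\<Oplus>k\<in>{..<n}. A $$ (i, k) \<otimes> (if k = j then \<one> else \<zero>)) = A $$ (i, j)"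
        if "i < n" "j < n" for i j
      proof -
        have "(\<Oplus>k\<in>{..<n}. A $$ (i, k) \<otimes> (if k = j then \<one> else \<zero>)) =
          (\<Oplus>k\<in>{..<n}. if j = k then A $$ (i, k) else \<zero>)"
          using that cl by (intro finsum_cong') auto
        also have "\<dots> = A $$ (i, j)"
          using that cl by (intro add.finprod_singleton) auto
        finally show ?thesis .
      qed
      have one: "\<one>\<^bsub>?M\<^esub> \<otimes>\<^bsub>?M\<^esub> A =
          mat n n (\<lambda>(i, j). \<Oplus>k\<in>{..<n}. (if i = k then \<one> else \<zero>) \<otimes> A $$ (k, j))"
        "A \<otimes>\<^bsub>?M\<^esub> \<one>\<^bsub>?M\<^esub> =
          mat n n (\<lambda>(i, j). \<Oplus>k\<in>{..<n}. A $$ (i, k) \<otimes> (if k = j then \<one> else \<zero>))"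
        using cl by (auto simp: M intro!: eq_matI finsum_cong')
      show "\<one>\<^bsub>?M\<^esub> \<otimes>\<^bsub>?M\<^esub> A = A" "A \<otimes>\<^bsub>?M\<^esub> \<one>\<^bsub>?M\<^esub> = A"
        using A unfolding one by (auto simp: l r M intro!: eq_matI)
    qed
  next
    fix A B C assume ABC: "A \<in> carrier ?M" "B \<in> carrier ?M" "C \<in> carrier ?M"
    then have cl: "A $$ (k, l) \<in> carrier R" "B $$ (k, l) \<in> carrier R" "C $$ (k, l) \<in> carrier R"
      if "k < n" "l < n" for k l using that by (auto simp: M)
    have "(\<Oplus>k\<in>{..<n}. (A $$ (i, k) \<oplus> B $$ (i, k)) \<otimes> C $$ (k, j)) =
        (\<Oplus>k\<in>{..<n}. A $$ (i, k) \<otimes> C $$ (k, j)) \<oplus> (\<Oplus>k\<in>{..<n}. B $$ (i, k) \<otimes> C $$ (k, j))"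
      if "i < n" "j < n" for i j
    proof -
      have "(\<Oplus>k\<in>{..<n}. (A $$ (i, k) \<oplus> B $$ (i, k)) \<otimes> C $$ (k, j)) =
          (\<Oplus>k\<in>{..<n}. A $$ (i, k) \<otimes> C $$ (k, j) \<oplus> B $$ (i, k) \<otimes> C $$ (k, j))"
        using that cl by (intro finsum_cong') (auto simp: l_distr)
      then show ?thesis using that cl by (simp add: finsum_addf)
    qed
    moreover have "(A \<oplus>\<^bsub>?M\<^esub> B) \<otimes>\<^bsub>?M\<^esub> C =
        mat n n (\<lambda>(i, j). \<Oplus>k\<in>{..<n}. (A $$ (i, k) \<oplus> B $$ (i, k)) \<otimes> C $$ (k, j))"
      using cl by (auto simp: M intro!: eq_matI finsum_cong')
    ultimately show "(A \<oplus>\<^bsub>?M\<^esub> B) \<otimes>\<^bsub>?M\<^esub> C = A \<otimes>\<^bsub>?M\<^esub> C \<oplus>\<^bsub>?M\<^esub> B \<otimes>\<^bsub>?M\<^esub> C"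
      by (auto simp: M intro!: eq_matI)
    have "(\<Oplus>k\<in>{..<n}. C $$ (i, k) \<otimes> (A $$ (k, j) \<oplus> B $$ (k, j))) =
        (\<Oplus>k\<in>{..<n}. C $$ (i, k) \<otimes> A $$ (k, j)) \<oplus> (\<Oplus>k\<in>{..<n}. C $$ (i, k) \<otimes> B $$ (k, j))"
      if "i < n" "j < n" for i j
    proof -
      have "(\<Oplus>k\<in>{..<n}. C $$ (i, k) \<otimes> (A $$ (k, j) \<oplus> B $$ (k, j))) =
          (\<Oplus>k\<in>{..<n}. C $$ (i, k) \<otimes> A $$ (k, j) \<oplus> C $$ (i, k) \<otimes> B $$ (k, j))"
        using that cl by (intro finsum_cong') (auto simp: r_distr)
      then show ?thesis using that cl by (simp add: finsum_addf)
    qed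
    moreover have "C \<otimes>\<^bsub>?M\<^esub> (A \<oplus>\<^bsub>?M\<^esub> B) =
        mat n n (\<lambda>(i, j). \<Oplus>k\<in>{..<n}. C $$ (i, k) \<otimes> (A $$ (k, j) \<oplus> B $$ (k, j)))"
      using cl by (auto simp: M intro!: eq_matI finsum_cong')
    ultimately show "C \<otimes>\<^bsub>?M\<^esub> (A \<oplus>\<^bsub>?M\<^esub> B) = C \<otimes>\<^bsub>?M\<^esub> A \<oplus>\<^bsub>?M\<^esub> C \<otimes>\<^bsub>?M\<^esub> B"
      by (auto simp: M intro!: eq_matI)
  qed
qed

end

theory Submission
  imports Defs "HOL-Algebra.QuotRing" "HOL-Algebra.UnivPoly" "HOL-Computational_Algebra.Primes"
begin

text \<open>Let \<open>N\<close> be the set of nilpotent elements of \<open>R\<close>, an ideal by hypothesis. Every element outside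
  the radical \<open>J\<close> is torsion modulo \<open>N\<close>; applied to integers this gives \<open>R\<close> positive characteristic
  with residue characteristic a prime \<open>q \<in> N\<close>. For \<open>j \<in> J\<close> some \<open>(1 + j)\<^sup>m\<close> is \<open>1\<close> modulo \<open>N\<close>; splitting
  off the \<open>q\<close>-part of \<open>m\<close> by Frobenius forces \<open>j\<close> to be nilpotent, so \<open>J = N\<close> and \<open>R/N\<close> is a division
  ring whose nonzero elements are torsion.

  Over such a division ring every nonzero square matrix is a torsion unit plus a nilpotent. If, after
  conjugating by transvections, \<open>A\<close> has a nonzero diagonal entry whose complementary minor block is
  nonzero, one takes block lower triangular parts and inducts; only a \<open>2 \<times> 2\<close> case escapes this, and
  there a unit with diagonal cube is written down. Jacobson's commutativity theorem is avoided: block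
  triangular units with torsion diagonal are torsion because the characteristic is positive.

  The decomposition lifts along \<open>M\<^sub>n(R) \<rightarrow> M\<^sub>n(R/N)\<close> because the kernel \<open>M\<^sub>n(N)\<close> is nil by local nilpotence,
  and \<open>M\<^sub>n(N)\<close> is the Jacobson radical of \<open>M\<^sub>n(R)\<close>.\<close>

section \<open>Nilpotent and torsion elements\<close>

context ring
begin

text \<open>Splitting \<open>a^(k+1) - b^(k+1)\<close> as \<open>(a^k - b^k) a + b^k (a - b)\<close>
  keeps every factor on its own side, as a noncommutative ring demands.\<close>

lemma ideal_pow_minus:
  assumes "ideal K R" "a \<in> carrier R" "b \<in> carrier R" "a \<ominus> b \<in> K"
  shows "a [^] (k::nat) \<ominus> b [^] k \<in> K"
proof -
  interpret K: ideal K R by fact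
  show ?thesis
  proof (induction k)
    case 0
    then show ?case by (simp add: a_minus_def r_neg)
  next
    case (Suc k)
    have "a [^] Suc k \<ominus> b [^] Suc k = (a [^] k \<ominus> b [^] k) \<otimes> a \<oplus> b [^] k \<otimes> (a \<ominus> b)"
      using assms by (simp add: a_minus_def l_distr r_distr l_minus r_minus a_ac r_neg1 r_neg2 l_neg r_neg)
    moreover have "(a [^] k \<ominus> b [^] k) \<otimes> a \<in> K"
      using Suc assms K.I_r_closed by simp
    moreover have "b [^] k \<otimes> (a \<ominus> b) \<in> K"
      using assms K.I_l_closed by simp
    ultimately show ?case by (simp only: K.a_closed)
  qed
qed

section \<open>Powers of \<open>1 + x\<close> and torsion of unipotent elements\<close>

lemma add_pow_one_mult:
  assumes "x \<in> carrier R"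
  shows "([(n::nat)] \<cdot> \<one>) \<otimes> x = [n] \<cdot> x" "x \<otimes> ([(n::nat)] \<cdot> \<one>) = [n] \<cdot> x"
  using assms by (simp_all add: add_pow_ldistr add_pow_rdistr)

text \<open>This is the binomial expansion cut after the linear term:
  \<open>1 + m x + x^2 h\<close>. The factor \<open>x\<close> stays in front so that the linear term
  can be killed by the characteristic, or the cofactor of \<open>x\<close> cancelled modulo an
  ideal.\<close>

lemma one_plus_pow:
  assumes x: "x \<in> carrier R"
  shows "\<exists>h\<in>carrier R. h \<otimes> x = x \<otimes> h \<and>
    (\<one> \<oplus> x) [^] (m::nat) = \<one> \<oplus> x \<otimes> ([m] \<cdot> \<one> \<oplus> x \<otimes> h)"
proof (induction m)
  case 0
  show ?case using x by (intro bexI[of _ \<zero>]) auto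
next
  case (Suc m)
  then obtain h where h: "h \<in> carrier R" "h \<otimes> x = x \<otimes> h"
    "(\<one> \<oplus> x) [^] m = \<one> \<oplus> x \<otimes> ([m] \<cdot> \<one> \<oplus> x \<otimes> h)" by auto
  \<comment> \<open>The new witness is read off from \<open>(1 + m x + x^2 h) (1 + x) = 1 + (m + 1)
    x + x^2 (m + h + x h)\<close>.\<close>
  have c: "[m] \<cdot> \<one> \<oplus> h \<oplus> x \<otimes> h \<in> carrier R" using x h by simp
  show ?case
  proof (intro bexI[OF _ c] conjI)
    show "([m] \<cdot> \<one> \<oplus> h \<oplus> x \<otimes> h) \<otimes> x = x \<otimes> ([m] \<cdot> \<one> \<oplus> h \<oplus> x \<otimes> h)"
      using x h by (simp add: l_distr r_distr m_assoc add_pow_one_mult)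
    have "(\<one> \<oplus> x) [^] Suc m = \<one> \<oplus> x \<oplus> (x \<otimes> ([m] \<cdot> \<one>) \<oplus> x \<otimes> (x \<otimes> h)) \<oplus> (x \<otimes> ([m] \<cdot> \<one>) \<oplus> x \<otimes> (x \<otimes> h)) \<otimes> x"
      using x h by (simp add: l_distr r_distr a_ac)
    also have "(x \<otimes> ([m] \<cdot> \<one>) \<oplus> x \<otimes> (x \<otimes> h)) \<otimes> x = x \<otimes> (x \<otimes> ([m] \<cdot> \<one>) \<oplus> x \<otimes> (x \<otimes> h))"
      using x h by (simp add: l_distr r_distr m_assoc add_pow_one_mult add_pow_ldistr add_pow_rdistr)
    finally show "(\<one> \<oplus> x) [^] Suc m =
        \<one> \<oplus> x \<otimes> ([(Suc m)] \<cdot> \<one> \<oplus> x \<otimes> ([m] \<cdot> \<one> \<oplus> h \<oplus> x \<otimes> h))"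
      using x h by (simp add: l_distr r_distr a_ac)
  qed
qed

text \<open>Raising to the power \<open>c\<close> kills the linear term, so
  \<open>(1 + B)^c = 1 + B^2 h\<close> with \<open>h\<close> commuting with \<open>B\<close>. The
  new nilpotent part \<open>B^2 h\<close> already vanishes at exponent \<open>2^k\<close> when
  \<open>B\<close> does at \<open>2^(k+1)\<close>; hence the powers of two.\<close>

lemma unipotent_torsion:
  assumes c: "[(c::nat)] \<cdot> \<one> = \<zero>" "c \<ge> 1"
  shows "B \<in> carrier R \<Longrightarrow> B [^] ((2::nat) ^ k) = \<zero> \<Longrightarrow> \<exists>m\<ge>1::nat. (\<one> \<oplus> B) [^] m = \<one>"
proof (induction k arbitrary: B)
  case 0
  then show ?case by (intro exI[of _ 1]) simp
next
  case (Suc k)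
  obtain h where h: "h \<in> carrier R" "h \<otimes> B = B \<otimes> h"
    "(\<one> \<oplus> B) [^] c = \<one> \<oplus> B \<otimes> ([c] \<cdot> \<one> \<oplus> B \<otimes> h)"
    using one_plus_pow[OF Suc.prems(1), of c] by blast
  let ?B = "B \<otimes> (B \<otimes> h)"
  have p: "(B \<otimes> (B \<otimes> h)) [^] n = (B [^] (2::nat)) [^] n \<otimes> h [^] n" for n :: nat
  proof -
    have "h \<otimes> (B [^] (2::nat)) = (B [^] (2::nat)) \<otimes> h"
      using h Suc.prems by (simp add: numeral_2_eq_2 m_assoc[symmetric]) (simp add: m_assoc)
    then have "(B [^] (2::nat) \<otimes> h) [^] n = (B [^] (2::nat)) [^] n \<otimes> h [^] n"
      using h Suc.prems pow_mult_distrib[of "B [^] (2::nat)" h n] by simp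
    then show ?thesis using h Suc.prems by (simp add: numeral_2_eq_2 m_assoc)
  qed
  have "(B [^] (2::nat)) [^] ((2::nat) ^ k) = \<zero>"
    using Suc.prems by (simp add: nat_pow_pow)
  then have "?B [^] ((2::nat) ^ k) = \<zero>" using h p by simp
  then obtain m where m: "m \<ge> 1" "(\<one> \<oplus> ?B) [^] (m::nat) = \<one>"
    using Suc.IH[of ?B] h Suc.prems by auto
  have "(\<one> \<oplus> B) [^] (c * m) = \<one>"
    using m h c Suc.prems by (simp flip: nat_pow_pow)
  then show ?case using c m by (intro exI[of _ "c * m"]) auto
qed

lemma one_plus_nilpotent_torsion:
  assumes "[(c::nat)] \<cdot> \<one> = \<zero>" "c \<ge> 1" "B \<in> carrier R" "B [^] (k::nat) = \<zero>"
  shows "\<exists>m\<ge>1::nat. (\<one> \<oplus> B) [^] m = \<one>"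
proof -
  have "k \<le> 2 ^ k" by (simp add: less_imp_le)
  then have "B [^] ((2::nat) ^ k) = B [^] k \<otimes> B [^] (2 ^ k - k)"
    using assms by (subst nat_pow_mult) auto
  then show ?thesis using assms unipotent_torsion[of c B k] by simp
qed

text \<open>The inverse is the geometric sum \<open>1 + x + ... + x^(k-1)\<close>, built up by the
  induction; multiplied by \<open>1 - x\<close> it telescopes to \<open>1 - x^k\<close>.\<close>

lemma one_minus_nilpotent_left_inverse:
  assumes x: "x \<in> carrier R"
  shows "x [^] (k::nat) = \<zero> \<Longrightarrow> \<exists>y\<in>carrier R. y \<otimes> (\<one> \<ominus> x) = \<one>"
proof -
  have "\<exists>y\<in>carrier R. y \<otimes> (\<one> \<ominus> x) = \<one> \<ominus> x [^] k" for k :: nat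
  proof (induction k)
    case 0
    show ?case using x by (intro bexI[of _ \<zero>]) (auto simp: a_minus_def r_neg)
  next
    case (Suc k)
    then obtain y where y: "y \<in> carrier R" "y \<otimes> (\<one> \<ominus> x) = \<one> \<ominus> x [^] k" by blast
    have "(y \<oplus> x [^] k) \<otimes> (\<one> \<ominus> x) = y \<otimes> (\<one> \<ominus> x) \<oplus> x [^] k \<otimes> (\<one> \<ominus> x)"
      using x y by (simp add: l_distr)
    also have "\<dots> = \<one> \<ominus> x [^] Suc k"
      unfolding y(2) using x
      by (simp add: a_minus_def r_distr r_minus a_ac r_neg1 r_neg2)
    finally show ?case using x y by (intro bexI[of _ "y \<oplus> x [^] k"]) auto
  qed
  then show "x [^] k = \<zero> \<Longrightarrow> ?thesis"
    by (metis a_minus_def minus_zero one_closed r_zero)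
qed

section \<open>The binomial theorem and the Frobenius map\<close>

lemma binomial_one_plus:
  assumes x: "x \<in> carrier R"
  shows "(\<one> \<oplus> x) [^] (n::nat) = (\<Oplus>i\<in>{..n}. [(n choose i)] \<cdot> (x [^] i))"
proof (induction n)
  case 0
  then show ?case by simp
next
  case (Suc n)
  \<comment> \<open>The sum is prolonged by a term with coefficient zero, so that after splitting
    off the term \<open>1\<close> it pairs with the shifted sum \<open>b\<close> under Pascal's
    rule.\<close>
  have a: "(\<Oplus>i\<in>{..Suc n}. [(n choose i)] \<cdot> (x [^] i)) = (\<one> \<oplus> x) [^] n"
    using x Suc by (simp add: binomial_eq_0)
  have b: "(\<Oplus>i\<in>{..n}. [(n choose i)] \<cdot> (x [^] Suc i)) = (\<one> \<oplus> x) [^] n \<otimes> x"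
    unfolding Suc using x
    by (simp add: finsum_ldistr add_pow_ldistr)
  have "(\<Oplus>i\<in>{..Suc n}. [(Suc n choose i)] \<cdot> (x [^] i)) =
      (\<Oplus>i\<in>{..n}. [(Suc n choose Suc i)] \<cdot> (x [^] Suc i)) \<oplus> \<one>"
    using x by (subst finsum_Suc2) auto
  also have "\<dots> = (\<Oplus>i\<in>{..n}. [(n choose Suc i)] \<cdot> (x [^] Suc i) \<oplus> [(n choose i)] \<cdot> (x [^] Suc i)) \<oplus> \<one>"
    using x by (intro arg_cong2[where f="(\<oplus>)"] finsum_cong') (auto simp: add.nat_pow_mult a_comm)
  also have "\<dots> = (\<Oplus>i\<in>{..n}. [(n choose Suc i)] \<cdot> (x [^] Suc i)) \<oplus> \<one> \<oplus>
      (\<Oplus>i\<in>{..n}. [(n choose i)] \<cdot> (x [^] Suc i))"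
    using x by (subst finsum_addf) (auto simp: a_ac)
  also have "(\<Oplus>i\<in>{..n}. [(n choose Suc i)] \<cdot> (x [^] Suc i)) \<oplus> \<one> = (\<Oplus>i\<in>{..Suc n}. [(n choose i)] \<cdot> (x [^] i))"
    using x by (subst finsum_Suc2) auto
  finally show ?case using x a b by (simp add: r_distr)
qed

text \<open>All inner binomial coefficients are divisible by \<open>q\<close>, so only the two end
  terms survive. The intended ring is \<open>R/N\<close>, where the residue characteristic is
  zero.\<close>

lemma one_plus_pow_prime:
  assumes x: "x \<in> carrier R" and q: "prime (q::nat)" "[q] \<cdot> \<one> = \<zero>"
  shows "(\<one> \<oplus> x) [^] q = \<one> \<oplus> x [^] q"
proof -
  have z: "[(q choose i)] \<cdot> (x [^] i) = \<zero>" if "i \<noteq> 0" "i < q" for i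
  proof -
    have "q dvd q choose i" using that q by (intro dvd_choose_prime) auto
    then obtain d where "q choose i = q * d" by (rule dvdE)
    then have "[(q choose i)] \<cdot> (x [^] i) = [d] \<cdot> ([q] \<cdot> (x [^] i))"
      using x by (simp add: add.nat_pow_pow mult.commute)
    also have "[q] \<cdot> (x [^] i) = \<zero>"
      using add_pow_one_mult(1)[of "x [^] i" q] x q by simp
    finally show ?thesis by simp
  qed
  obtain r where r: "q = Suc r" using q by (cases q) auto
  have "(\<one> \<oplus> x) [^] q = (\<Oplus>i\<in>{..q}. [(q choose i)] \<cdot> (x [^] i))"
    by (rule binomial_one_plus[OF x])
  also have "\<dots> = x [^] q \<oplus> (\<Oplus>i\<in>{..r}. [(q choose i)] \<cdot> (x [^] i))"
    unfolding r using x by simp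
  also have "(\<Oplus>i\<in>{..r}. [(q choose i)] \<cdot> (x [^] i)) = (\<Oplus>i\<in>{..r}. if 0 = i then \<one> else \<zero>)"
    using x z r by (intro finsum_cong') auto
  also have "\<dots> = \<one>"
    by (subst finsum_singleton[where f="\<lambda>_. \<one>"]) auto
  finally show ?thesis using x by (simp add: a_comm)
qed

lemma one_plus_pow_prime_power:
  assumes x: "x \<in> carrier R" and q: "prime (q::nat)" "[q] \<cdot> \<one> = \<zero>"
  shows "(\<one> \<oplus> x) [^] (q ^ s) = \<one> \<oplus> x [^] (q ^ s)"
proof (induction s)
  case (Suc s)
  have "(\<one> \<oplus> x) [^] (q ^ Suc s) = ((\<one> \<oplus> x) [^] (q ^ s)) [^] q"
    using x by (simp add: nat_pow_pow mult.commute)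
  then show ?case
    using x q Suc by (simp add: one_plus_pow_prime nat_pow_pow mult.commute)
qed (use x in auto)

text \<open>If a maximal left ideal \<open>I\<close> did not contain \<open>K\<close>, then
  \<open>I + K\<close> would be the whole ring and \<open>1 = i + k\<close>. As \<open>k\<close> is
  nilpotent, \<open>i = 1 - k\<close> has a left inverse, which forces \<open>1\<close> into
  \<open>I\<close>.\<close>

lemma nil_ideal_subset_jacobson_radical:
  assumes K: "ideal K R" and nil: "\<And>x. x \<in> K \<Longrightarrow> \<exists>k::nat. x [^] k = \<zero>"
  shows "K \<subseteq> jacobson_radical R"
proof -
  interpret K: ideal K R by fact
  have "x \<in> I" if x: "x \<in> K" and I: "maximal_left_ideal I R" for x I
  proof (rule ccontr)
    assume nx: "x \<notin> I"
    interpret I: additive_subgroup I R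
      using I by (auto simp: maximal_left_ideal_def left_ideal_def)
    have Il: "a \<otimes> y \<in> I" if "a \<in> carrier R" "y \<in> I" for a y
      using I that by (auto simp: maximal_left_ideal_def left_ideal_def)
    have mem: "z \<in> I <+>\<^bsub>R\<^esub> K \<longleftrightarrow> (\<exists>i\<in>I. \<exists>k\<in>K. z = i \<oplus> k)" for z
      by (auto simp: set_add_def')
    have "left_ideal (I <+>\<^bsub>R\<^esub> K) R"
      unfolding left_ideal_def
    proof (intro conjI ballI)
      show "additive_subgroup (I <+>\<^bsub>R\<^esub> K) R"
        by (rule add_additive_subgroups) unfold_locales
      fix a y assume a: "a \<in> carrier R" and "y \<in> I <+>\<^bsub>R\<^esub> K"
      then obtain i k where "i \<in> I" "k \<in> K" "y = i \<oplus> k" by (auto simp: mem)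
      then have "a \<otimes> y = a \<otimes> i \<oplus> a \<otimes> k" "a \<otimes> i \<in> I" "a \<otimes> k \<in> K"
        using a by (auto simp: r_distr I.a_Hcarr Il K.I_l_closed)
      then show "a \<otimes> y \<in> I <+>\<^bsub>R\<^esub> K" by (auto simp: mem)
    qed
    moreover have "I \<subseteq> I <+>\<^bsub>R\<^esub> K"
      unfolding subset_iff mem by (metis I.a_Hcarr K.zero_closed r_zero)
    moreover have "x \<in> I <+>\<^bsub>R\<^esub> K"
      unfolding mem by (metis x I.zero_closed K.a_Hcarr l_zero)
    ultimately have "I <+>\<^bsub>R\<^esub> K = carrier R"
      using I nx by (auto simp: maximal_left_ideal_def)
    then obtain i k where ik: "i \<in> I" "k \<in> K" "\<one> = i \<oplus> k"
      using mem[of \<one>] by auto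
    then have i: "i = \<one> \<ominus> k"
      using I.a_Hcarr K.a_Hcarr by (simp add: a_minus_def a_assoc r_neg)
    obtain l :: nat where "k [^] l = \<zero>" using nil ik by blast
    then obtain y where "y \<in> carrier R" "y \<otimes> i = \<one>"
      unfolding i using one_minus_nilpotent_left_inverse ik K.a_Hcarr by blast
    then have "\<one> \<in> I" using Il ik by metis
    then have "I = carrier R" using Il I.a_subset by (metis r_one subsetI subset_antisym)
    then show False using I by (auto simp: maximal_left_ideal_def)
  qed
  then show ?thesis by (auto simp: jacobson_radical_def)
qed

end

section \<open>The radical of a generalized t-fine ring\<close>

text \<open>The radical of \<open>R\<close> is computed from the ideal property of the nilpotents;
  their local nilpotence joins in the locale for matrices.\<close>

locale nil_ideal_t_fine_ring = ring R for R (structure) +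
  assumes nil_ideal: "ideal (nilpotents R) R"
    and t_fine: "generalized_t_fine R"
begin

abbreviation "N \<equiv> nilpotents R"
abbreviation "J \<equiv> jacobson_radical R"

sublocale N: ideal N R by (rule nil_ideal)

section \<open>Elements outside \<open>J\<close> are torsion modulo \<open>N\<close>\<close>

lemma in_J_iff: "x \<in> J \<longleftrightarrow> x \<in> carrier R \<and> (\<forall>I. maximal_left_ideal I R \<longrightarrow> x \<in> I)"
  by (simp add: jacobson_radical_def)

lemma maximal_left_idealD:
  assumes "maximal_left_ideal I R"
  shows "additive_subgroup I R" "a \<in> carrier R \<Longrightarrow> x \<in> I \<Longrightarrow> a \<otimes> x \<in> I"
  using assms by (simp_all add: maximal_left_ideal_def left_ideal_def)

lemma minus_minus_cancel: "x \<in> carrier R \<Longrightarrow> y \<in> carrier R \<Longrightarrow> x \<ominus> (x \<ominus> y) = y"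
  by (simp add: a_minus_def minus_add a_assoc[symmetric] r_neg)

lemma add_minus_cancel: "x \<in> carrier R \<Longrightarrow> y \<in> carrier R \<Longrightarrow> (x \<oplus> y) \<ominus> x = y"
  by (simp add: a_minus_def a_comm[of x y] a_assoc r_neg)

lemma add_minus_cancel': "x \<in> carrier R \<Longrightarrow> y \<in> carrier R \<Longrightarrow> (x \<oplus> y) \<ominus> y = x"
  by (simp add: a_minus_def a_assoc r_neg)

lemma zero_in_J: "\<zero> \<in> J"
  unfolding in_J_iff using additive_subgroup.zero_closed[OF maximal_left_idealD(1)] by blast

lemma J_carrier: "x \<in> J \<Longrightarrow> x \<in> carrier R"
  by (simp add: in_J_iff)

lemma J_add: "x \<in> J \<Longrightarrow> y \<in> J \<Longrightarrow> x \<oplus> y \<in> J"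
  unfolding in_J_iff using additive_subgroup.a_closed[OF maximal_left_idealD(1)] a_closed by blast

lemma J_mult: "a \<in> carrier R \<Longrightarrow> x \<in> J \<Longrightarrow> a \<otimes> x \<in> J"
  unfolding in_J_iff using maximal_left_idealD(2) m_closed by blast

lemma J_uminus: "x \<in> J \<Longrightarrow> \<ominus> x \<in> J"
  using J_mult[of "\<ominus> \<one>" x] J_carrier[of x] by (simp add: l_minus)

lemma J_minus: "x \<in> J \<Longrightarrow> y \<in> J \<Longrightarrow> x \<ominus> y \<in> J"
  unfolding a_minus_def by (intro J_add J_uminus)

lemma N_minus: "x \<in> N \<Longrightarrow> y \<in> N \<Longrightarrow> x \<ominus> y \<in> N"
  unfolding a_minus_def by (intro N.a_closed N.a_inv_closed)

lemma notin_J_obtain: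
  assumes "a \<in> carrier R" "a \<notin> J"
  obtains t b m where "t \<in> Units R" "(m::nat) \<ge> 1" "t [^] m = \<one>" "b \<in> N" "a = t \<oplus> b"
proof -
  have "a \<in> torsion_units R <+>\<^bsub>R\<^esub> N"
    using assms t_fine by (auto simp: generalized_t_fine_def)
  then show thesis using that by (auto simp: set_add_def' torsion_units_def)
qed

lemma sum_notin_J:
  assumes "t \<in> Units R" "(m::nat) \<ge> 1" "t [^] m = \<one>" "b \<in> N"
  shows "t \<oplus> b \<notin> J"
proof -
  have "t \<in> torsion_units R" using assms by (auto simp: torsion_units_def)
  then have "t \<oplus> b \<in> torsion_units R <+>\<^bsub>R\<^esub> N"
    using assms by (auto simp: set_add_def')
  then show ?thesis using t_fine by (auto simp: generalized_t_fine_def)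
qed

text \<open>The sum \<open>1 + 0\<close> is a torsion unit plus a nilpotent. In particular
  \<open>R\<close> is not the zero ring.\<close>

lemma one_notin_J: "\<one> \<notin> J"
  using sum_notin_J[of \<one> 1 \<zero>] by simp

lemma one_neq_zero: "\<one> \<noteq> \<zero>"
  using one_notin_J zero_in_J by metis

lemma in_N_iff: "x \<in> N \<longleftrightarrow> x \<in> carrier R \<and> (\<exists>k::nat. x [^] k = \<zero>)"
  unfolding nilpotents_def by blast

lemma one_notin_N: "\<one> \<notin> N"
proof
  assume "\<one> \<in> N"
  then obtain k :: nat where "\<one> [^] k = \<zero>" using in_N_iff by blast
  then show False using one_neq_zero by (simp only: nat_pow_one)
qed

lemma pow_in_N:
  assumes "x \<in> carrier R" "x [^] (k::nat) \<in> N"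
  shows "x \<in> N"
proof -
  obtain n :: nat where "(x [^] k) [^] n = \<zero>"
    using assms(2) in_N_iff by blast
  then have "x [^] (k * n) = \<zero>" using assms(1) by (simp add: nat_pow_pow)
  then show ?thesis using assms(1) in_N_iff by blast
qed

text \<open>In a decomposition \<open>a = t + b\<close> the element \<open>a\<close> is congruent to
  the torsion unit \<open>t\<close>, hence \<open>a^m\<close> to \<open>t^m = 1\<close>. From here
  on, elements outside \<open>J\<close> are handled through this congruence.\<close>

lemma torsion_mod_N:
  assumes "a \<in> carrier R" "a \<notin> J"
  obtains m where "(m::nat) \<ge> 1" "a [^] m \<ominus> \<one> \<in> N"
proof -
  obtain t b and m :: nat where tb: "t \<in> Units R" "m \<ge> 1" "t [^] m = \<one>" "b \<in> N" "a = t \<oplus> b"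
    using notin_J_obtain[OF assms] by metis
  then have "a \<ominus> t = b"
    using add_minus_cancel[OF Units_closed N.a_Hcarr] by simp
  then have "a [^] m \<ominus> t [^] m \<in> N"
    using tb assms by (intro ideal_pow_minus[OF nil_ideal]) auto
  then show thesis using that tb by simp
qed

text \<open>A nilpotent \<open>x\<close> outside \<open>J\<close> would have both \<open>x^m\<close>
  and \<open>x^m - 1\<close> in the ideal \<open>N\<close>, so \<open>1\<close> would be
  nilpotent.\<close>

lemma N_subset_J: "N \<subseteq> J"
proof
  fix x assume x: "x \<in> N"
  show "x \<in> J"
  proof (rule ccontr)
    assume "x \<notin> J"
    then obtain m :: nat where m: "m \<ge> 1" "x [^] m \<ominus> \<one> \<in> N"
      using torsion_mod_N x by (metis N.a_Hcarr)
    obtain l where l: "m = Suc l" using m by (cases m) auto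
    have "x [^] m \<in> N" using x unfolding l by (simp add: N.I_l_closed)
    then have "x [^] m \<ominus> (x [^] m \<ominus> \<one>) \<in> N" using m by (simp add: a_minus_def)
    also have "x [^] m \<ominus> (x [^] m \<ominus> \<one>) = \<one>"
      using N.a_Hcarr[OF x] by (intro minus_minus_cancel) auto
    finally show False using one_notin_N by simp
  qed
qed

lemma pow_mod_cancel:
  assumes "y \<in> carrier R" "z \<in> carrier R" "z \<ominus> \<one> \<in> N"
  shows "z \<otimes> y \<ominus> y \<in> N" "y \<otimes> z \<ominus> y \<in> N"
proof -
  have "z \<otimes> y \<ominus> y = (z \<ominus> \<one>) \<otimes> y" "y \<otimes> z \<ominus> y = y \<otimes> (z \<ominus> \<one>)"
    using assms by (simp_all add: a_minus_def l_distr r_distr l_minus r_minus)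
  then show "z \<otimes> y \<ominus> y \<in> N" "y \<otimes> z \<ominus> y \<in> N"
    using assms by (simp_all add: N.I_l_closed N.I_r_closed)
qed

text \<open>Some power \<open>a^m\<close> is congruent to \<open>1\<close>, so
  \<open>a^(m-1)\<close> inverts \<open>a\<close> modulo \<open>N\<close> from either side.\<close>

lemma N_cancel:
  assumes a: "a \<in> carrier R" "a \<notin> J" and y: "y \<in> carrier R"
  shows "a \<otimes> y \<in> N \<Longrightarrow> y \<in> N" "y \<otimes> a \<in> N \<Longrightarrow> y \<in> N"
proof -
  obtain m :: nat where m: "m \<ge> 1" "a [^] m \<ominus> \<one> \<in> N"
    using torsion_mod_N a by metis
  obtain l where l: "m = Suc l" using m by (cases m) auto
  note c = pow_mod_cancel[OF y _ m(2)]
  { assume "a \<otimes> y \<in> N"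
    then have "a [^] m \<otimes> y \<in> N"
      using a y unfolding l by (simp add: m_assoc N.I_l_closed)
    then have "a [^] m \<otimes> y \<ominus> (a [^] m \<otimes> y \<ominus> y) \<in> N"
      by (rule N_minus) (use c(1) a in simp)
    also have "a [^] m \<otimes> y \<ominus> (a [^] m \<otimes> y \<ominus> y) = y"
      using a y by (intro minus_minus_cancel) auto
    finally show "y \<in> N" .
  next
    assume "y \<otimes> a \<in> N"
    then have "y \<otimes> a [^] m \<in> N"
      using a y unfolding l by (simp only: nat_pow_Suc2 m_assoc[symmetric] N.I_r_closed nat_pow_closed)
    then have "y \<otimes> a [^] m \<ominus> (y \<otimes> a [^] m \<ominus> y) \<in> N"
      by (rule N_minus) (use c(2) a in simp)
    also have "y \<otimes> a [^] m \<ominus> (y \<otimes> a [^] m \<ominus> y) = y"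
      using a y by (intro minus_minus_cancel) auto
    finally show "y \<in> N" . }
qed

text \<open>The product \<open>a^m b\<close> is congruent to \<open>b\<close> modulo
  \<open>N\<close>, which lies in \<open>J\<close>. So far \<open>J\<close> is known only as a left
  ideal, and all multiplications here are from the left.\<close>

lemma mult_notin_J:
  assumes a: "a \<in> carrier R" "a \<notin> J" and b: "b \<in> carrier R" "b \<notin> J"
  shows "a \<otimes> b \<notin> J"
proof
  assume ab: "a \<otimes> b \<in> J"
  obtain m :: nat where m: "m \<ge> 1" "a [^] m \<ominus> \<one> \<in> N"
    using torsion_mod_N a by metis
  obtain l where l: "m = Suc l" using m by (cases m) auto
  have "a [^] m \<otimes> b \<in> J"
    using a b ab J_mult[of "a [^] l" "a \<otimes> b"] unfolding l by (simp add: m_assoc)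
  moreover have "a [^] m \<otimes> b \<ominus> b \<in> J"
    using pow_mod_cancel(1)[OF b(1) _ m(2)] a N_subset_J by auto
  ultimately have "a [^] m \<otimes> b \<ominus> (a [^] m \<otimes> b \<ominus> b) \<in> J"
    by (rule J_minus)
  also have "a [^] m \<otimes> b \<ominus> (a [^] m \<otimes> b \<ominus> b) = b"
    using a b by (intro minus_minus_cancel) auto
  finally show False using b by simp
qed

lemma J_add_notin:
  assumes "a \<in> carrier R" "a \<notin> J" "x \<in> J"
  shows "a \<oplus> x \<notin> J"
proof
  assume "a \<oplus> x \<in> J"
  then have "a \<oplus> x \<ominus> x \<in> J" using assms(3) by (rule J_minus)
  also have "a \<oplus> x \<ominus> x = a"
    by (rule add_minus_cancel'[OF assms(1) J_carrier[OF assms(3)]])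
  finally show False using assms by simp
qed

section \<open>Integers in \<open>R\<close>: characteristic and residue characteristic\<close>

abbreviation int_in :: "nat \<Rightarrow> 'a" where "int_in k \<equiv> [k] \<cdot> \<one>"

lemma int_in_mult: "int_in (a * b) = int_in a \<otimes> int_in b"
  using add_pow_one_mult(1)[of "int_in b" a] by (simp add: add.nat_pow_pow mult.commute)

lemma int_in_add: "int_in (a + b) = int_in a \<oplus> int_in b"
  by (simp add: add.nat_pow_mult)

lemma int_in_1: "int_in 1 = \<one>"
  using add.nat_pow_Suc[of 0 \<one>] by simp

lemma int_in_pow: "int_in (a ^ k) = int_in a [^] k"
  by (induction k) (simp_all add: mult.commute[of a] int_in_mult)

text \<open>Torsion modulo \<open>N\<close> makes the integer \<open>k^m - 1\<close> nilpotent in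
  \<open>R\<close>. A power of it is then a positive integer that vanishes in \<open>R\<close>;
  positivity comes from \<open>k \<ge> 2\<close>.\<close>

lemma int_in_torsion:
  assumes "k \<ge> 2" "int_in k \<notin> J"
  shows "\<exists>c\<ge>1. int_in c = \<zero>"
proof -
  obtain m :: nat where m: "m \<ge> 1" "int_in k [^] m \<ominus> \<one> \<in> N"
    using torsion_mod_N assms by (metis add.nat_pow_closed one_closed)
  have km: "k ^ m \<ge> 2"
    using assms(1) m(1) self_le_power[of k m] by linarith
  have "int_in (k ^ m) = int_in (k ^ m - 1) \<oplus> \<one>"
    using km by (metis int_in_1 int_in_add le_add_diff_inverse2 one_le_numeral order_trans)
  then have "int_in k [^] m \<ominus> \<one> = int_in (k ^ m - 1)"
    by (simp add: int_in_pow[symmetric] a_minus_def a_assoc r_neg del: One_nat_def)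
  then obtain l :: nat where "int_in (k ^ m - 1) [^] l = \<zero>"
    using m by (auto simp: in_N_iff)
  then have "int_in ((k ^ m - 1) ^ l) = \<zero>" by (simp add: int_in_pow)
  moreover have "(k ^ m - 1) ^ l \<ge> 1" using km by (intro one_le_power) simp
  ultimately show ?thesis by blast
qed

text \<open>One of the integers 2 and 3 lies outside \<open>J\<close>: if 2 is in \<open>J\<close>,
  then \<open>3 = 1 + 2\<close> is not.\<close>

lemma char_pos: "\<exists>c\<ge>1. int_in c = \<zero>"
proof (cases "int_in 2 \<in> J")
  case True
  have "int_in 3 = \<one> \<oplus> int_in 2"
    using int_in_add[of 1 2] unfolding int_in_1 by (metis numeral_eq_Suc one_plus_numeral semiring_norm(3) numeral_One)
  then have "int_in 3 \<notin> J" using J_add_notin[OF one_closed one_notin_J True] by simp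
  then show ?thesis using int_in_torsion[of 3] by simp
qed (use int_in_torsion[of 2] in simp)

text \<open>Take the least positive integer in \<open>J\<close>. Division with remainder gives the
  divisibility clause, and primality follows because products of elements outside \<open>J\<close>
  stay outside. Nilpotency of \<open>q\<close> needs a separate descent.\<close>

lemma residue_char:
  obtains q where "prime q" "int_in q \<in> N" "\<forall>k. int_in k \<in> J \<longrightarrow> q dvd k"
proof -
  define q where "q = (LEAST k. k \<ge> 1 \<and> int_in k \<in> J)"
  obtain c where c: "c \<ge> 1" "int_in c = \<zero>" using char_pos by blast
  have "c \<ge> 1 \<and> int_in c \<in> J" using c zero_in_J by metis
  then have q: "q \<ge> 1 \<and> int_in q \<in> J" unfolding q_def by (rule LeastI)
  have least: "int_in k \<notin> J" if "1 \<le> k" "k < q" for k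
    using that not_less_Least[of k "\<lambda>k. k \<ge> 1 \<and> int_in k \<in> J"] unfolding q_def by auto
  have dvd: "q dvd k" if "int_in k \<in> J" for k
  proof (rule ccontr)
    assume nd: "\<not> q dvd k"
    have "int_in k = int_in (k mod q) \<oplus> int_in (k div q) \<otimes> int_in q"
      by (metis int_in_add int_in_mult mod_div_mult_eq)
    moreover have "int_in (k mod q) \<notin> J"
      using nd q by (intro least) (auto simp: Suc_le_eq dvd_eq_mod_eq_0)
    ultimately show False
      using that q J_add_notin[of "int_in (k mod q)"] J_mult by simp
  qed
  have "q \<noteq> 1" using q one_notin_J by auto
  have "prime q"
  proof (rule prime_natI)
    show "q \<ge> 2" using q \<open>q \<noteq> 1\<close> by linarith
    fix a b assume "q dvd a * b"
    then obtain d where "a * b = q * d" by (rule dvdE)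
    then have "int_in (a * b) = int_in d \<otimes> int_in q" by (simp add: int_in_mult[symmetric] mult.commute)
    then have "int_in a \<otimes> int_in b \<in> J" using q J_mult by (simp add: int_in_mult)
    then show "q dvd a \<or> q dvd b" using dvd mult_notin_J by (metis add.nat_pow_closed one_closed)
  qed
  \<comment> \<open>Descent on a positive integer \<open>k\<close> whose image is nilpotent, started
    in the end at the \<open>c\<close> with image zero. Since \<open>k = q d\<close>, either
    \<open>d\<close> cancels modulo \<open>N\<close>, or \<open>d\<close> is a smaller such
    integer.\<close>
  moreover have "int_in k \<in> N \<Longrightarrow> k \<ge> 1 \<Longrightarrow> int_in q \<in> N" for k
  proof (induction k rule: less_induct)
    case (less k)
    obtain d where d: "k = q * d" using dvd less.prems N_subset_J by (meson dvdE subsetD)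
    show ?case
    proof (cases "int_in d \<in> J")
      case False
      then show ?thesis using less.prems N_cancel(2)[of "int_in d" "int_in q"] unfolding d int_in_mult by simp
    next
      case True
      then obtain e where e: "d = q * e" using dvd by (meson dvdE)
      \<comment> \<open>With \<open>d = q e\<close> and \<open>k = q d\<close>, both sides are the
        image of \<open>q^2 e^2\<close>.\<close>
      have "int_in d [^] (2::nat) = int_in k \<otimes> int_in e"
        unfolding int_in_pow[symmetric] int_in_mult[symmetric] d e by (simp add: power2_eq_square ac_simps)
      then have "int_in d [^] (2::nat) \<in> N" using less.prems N.I_r_closed by simp
      then have "int_in d \<in> N" by (rule pow_in_N[rotated]) simp
      moreover have "d < k" "d \<ge> 1"
        using d less.prems \<open>q \<noteq> 1\<close> q by (auto simp: Suc_le_eq)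
      ultimately show ?thesis using less.IH by blast
    qed
  qed
  ultimately show thesis using that dvd c N.zero_closed by metis
qed

section \<open>Every element of the radical is nilpotent\<close>

lemma coset_eq_zero_iff:
  assumes "x \<in> carrier R"
  shows "N +> x = \<zero>\<^bsub>R Quot N\<^esub> \<longleftrightarrow> x \<in> N"
proof -
  have "N +> x = N \<longleftrightarrow> x \<in> N"
    using assms N.a_rcos_const[of x] N.a_rcos_self[of x] by metis
  then show ?thesis by (simp only: FactRing_def ring.simps)
qed

lemma coset_int_in: "N +> int_in k = [k] \<cdot>\<^bsub>R Quot N\<^esub> \<one>\<^bsub>R Quot N\<^esub>"
proof -
  interpret h: ring_hom_ring R "R Quot N" "(+>) N" by (rule N.rcos_ring_hom_ring)
  show ?thesis by (induction k) auto
qed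

text \<open>Modulo \<open>N\<close>, Frobenius turns \<open>(1 + j)^m\<close> into
  \<open>(1 + y)^k\<close> with \<open>y = j^(q^s)\<close> and \<open>k\<close> prime to
  \<open>q\<close>. So \<open>y (k + y g)\<close> lies in \<open>N\<close>; the second factor is
  outside \<open>J\<close> and cancels, leaving a power of \<open>j\<close> in
  \<open>N\<close>.\<close>

lemma J_eq_N: "J = N"
proof
  show "J \<subseteq> N"
  proof
    fix j assume j: "j \<in> J"
    note jc = J_carrier[OF j]
    obtain q where q: "prime q" "int_in q \<in> N" "\<forall>k. int_in k \<in> J \<longrightarrow> q dvd k"
      using residue_char by metis
    have "\<one> \<oplus> j \<notin> J" using J_add_notin[OF one_closed one_notin_J j] .
    then obtain m :: nat where m: "m \<ge> 1" "(\<one> \<oplus> j) [^] m \<ominus> \<one> \<in> N"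
      using torsion_mod_N jc by (metis a_closed one_closed)
    have "m \<noteq> 0" "\<not> is_unit q" using m(1) q(1) by auto
    then obtain k where mk: "m = q ^ multiplicity q m * k" and k: "\<not> q dvd k"
      by (rule multiplicity_decompose')
    define s where "s = multiplicity q m"
    have sk: "m = q ^ s * k" using mk by (simp only: s_def)
    \<comment> \<open>In \<open>R\<close> the prime \<open>q\<close> is merely nilpotent, so
      Frobenius is applied in the quotient, where it is zero.\<close>
    interpret Q: ring "R Quot N" by (rule N.quotient_is_ring)
    interpret h: ring_hom_ring R "R Quot N" "(+>) N" by (rule N.rcos_ring_hom_ring)
    define y where "y = j [^] (q ^ s)"
    \<comment> \<open>The exponent \<open>q^s\<close> is positive, so a factor \<open>j\<close> is
      present and keeps \<open>y\<close> in \<open>J\<close>.\<close>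
    have y: "y \<in> carrier R" "y \<in> J"
    proof -
      have "q ^ s \<noteq> 0" using q(1) by auto
      then obtain l where "q ^ s = Suc l" using not0_implies_Suc by blast
      then show "y \<in> carrier R" "y \<in> J" using j jc by (auto simp: y_def J_mult)
    qed
    have "N +> (\<one> \<oplus> j) [^] m = N +> (\<one> \<oplus> y) [^] k"
      using jc y q(1) Q.one_plus_pow_prime_power[of "N +> j" q s] coset_eq_zero_iff[of "int_in q"] q(2)
      unfolding sk by (simp add: nat_pow_pow[symmetric] h.hom_nat_pow y_def coset_int_in)
    then have "N +> ((\<one> \<oplus> y) [^] k \<ominus> \<one>) = N +> ((\<one> \<oplus> j) [^] m \<ominus> \<one>)"
      using jc y by (simp add: a_minus_def)
    then have 1: "(\<one> \<oplus> y) [^] k \<ominus> \<one> \<in> N"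
      using m(2) coset_eq_zero_iff[of "(\<one> \<oplus> y) [^] k \<ominus> \<one>"] coset_eq_zero_iff[of "(\<one> \<oplus> j) [^] m \<ominus> \<one>"] jc y(1)
      by (simp only: minus_closed a_closed nat_pow_closed one_closed simp_thms)
    obtain g where g: "g \<in> carrier R" "g \<otimes> y = y \<otimes> g"
      "(\<one> \<oplus> y) [^] k = \<one> \<oplus> y \<otimes> (int_in k \<oplus> y \<otimes> g)"
      using one_plus_pow[OF y(1)] by blast
    have "(\<one> \<oplus> y) [^] k \<ominus> \<one> = y \<otimes> (int_in k \<oplus> y \<otimes> g)"
      unfolding g(3) using y g(1) by (simp add: a_minus_def a_assoc a_comm[of _ "\<ominus> \<one>"] r_neg1 r_neg2)
    \<comment> \<open>Commutation rewrites \<open>y g\<close> as \<open>g y\<close>, which the left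
      ideal \<open>J\<close> absorbs.\<close>
    moreover have "int_in k \<oplus> y \<otimes> g \<notin> J"
      using q(3) k J_mult[OF g(1) y(2)] g(2) by (intro J_add_notin) auto
    ultimately have "y \<in> N"
      using 1 y g N_cancel(2)[of "int_in k \<oplus> y \<otimes> g" y] by simp
    then show "j \<in> N" using pow_in_N[OF jc, of "q ^ s"] unfolding y_def by blast
  qed
qed (rule N_subset_J)

end

section \<open>Decompositions in corner rings\<close>

text \<open>The decomposition is taken in the corner ring \<open>e R e\<close>, whose identity is
  \<open>e\<close>: hence \<open>U^m = e\<close>. Corners of one fixed ring stand in for matrix
  rings of smaller size, so blocks can be added and multiplied without changing the ring.\<close>

definition fine_in :: "('a, 'm) ring_scheme \<Rightarrow> 'a \<Rightarrow> 'a \<Rightarrow> bool" where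
  "fine_in R e A \<longleftrightarrow> (\<exists>U\<in>carrier R. \<exists>X\<in>carrier R. A = U \<oplus>\<^bsub>R\<^esub> X \<and>
     e \<otimes>\<^bsub>R\<^esub> U = U \<and> U \<otimes>\<^bsub>R\<^esub> e = U \<and> e \<otimes>\<^bsub>R\<^esub> X = X \<and> X \<otimes>\<^bsub>R\<^esub> e = X \<and>
     (\<exists>m\<ge>1::nat. U [^]\<^bsub>R\<^esub> m = e) \<and> (\<exists>k::nat. X [^]\<^bsub>R\<^esub> k = \<zero>\<^bsub>R\<^esub>))"

context ring
begin

lemma conj_pow:
  assumes "P \<in> carrier R" "Q \<in> carrier R" "P \<otimes> Q = \<one>" "Q \<otimes> P = \<one>" "U \<in> carrier R"
  shows "(Q \<otimes> U \<otimes> P) [^] (m::nat) = Q \<otimes> U [^] m \<otimes> P"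
proof (induction m)
  case (Suc m)
  have "(Q \<otimes> U \<otimes> P) [^] Suc m = Q \<otimes> U [^] m \<otimes> (P \<otimes> Q) \<otimes> U \<otimes> P"
    unfolding nat_pow_Suc Suc.IH using assms(1,2,5) by (simp only: m_assoc m_closed nat_pow_closed)
  then show ?case using assms by (simp add: m_assoc)
qed (use assms in simp)

text \<open>Conjugating both summands back with \<open>Q\<close> and \<open>P\<close> keeps their
  exponents. Commutation with \<open>e\<close> keeps them in the corner and fixes \<open>e\<close>
  itself.\<close>

lemma fine_in_conj:
  assumes P: "P \<in> carrier R" "Q \<in> carrier R" "P \<otimes> Q = \<one>" "Q \<otimes> P = \<one>"
    and e: "e \<in> carrier R" "e \<otimes> P = P \<otimes> e" "e \<otimes> Q = Q \<otimes> e" and A: "A \<in> carrier R"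
    and "fine_in R e (P \<otimes> A \<otimes> Q)"
  shows "fine_in R e A"
proof -
  obtain U X m k where U: "U \<in> carrier R" "e \<otimes> U = U" "U \<otimes> e = U" "m \<ge> (1::nat)" "U [^] m = e"
    and X: "X \<in> carrier R" "e \<otimes> X = X" "X \<otimes> e = X" "X [^] (k::nat) = \<zero>"
    and AUX: "P \<otimes> A \<otimes> Q = U \<oplus> X"
    using assms(9) unfolding fine_in_def by metis
  have corner: "e \<otimes> (Q \<otimes> Y \<otimes> P) = Q \<otimes> Y \<otimes> P" "(Q \<otimes> Y \<otimes> P) \<otimes> e = Q \<otimes> Y \<otimes> P"
    if Y: "Y \<in> carrier R" "e \<otimes> Y = Y" "Y \<otimes> e = Y" for Y
  proof -
    have "e \<otimes> (Q \<otimes> Y \<otimes> P) = (e \<otimes> Q) \<otimes> Y \<otimes> P" using P(1,2) e(1) Y(1) by (simp only: m_assoc m_closed)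
    also have "\<dots> = Q \<otimes> (e \<otimes> Y) \<otimes> P"
      unfolding e(3) using P(1,2) e(1) Y(1) by (simp only: m_assoc m_closed)
    finally show "e \<otimes> (Q \<otimes> Y \<otimes> P) = Q \<otimes> Y \<otimes> P" by (simp only: Y(2))
    have "(Q \<otimes> Y \<otimes> P) \<otimes> e = Q \<otimes> (Y \<otimes> e) \<otimes> P"
      using P(1,2) e(1) Y(1) by (simp only: e(2)[symmetric] m_assoc m_closed)
    then show "(Q \<otimes> Y \<otimes> P) \<otimes> e = Q \<otimes> Y \<otimes> P" by (simp only: Y(3))
  qed
  have "Q \<otimes> (P \<otimes> A \<otimes> Q) \<otimes> P = (Q \<otimes> P) \<otimes> A \<otimes> (Q \<otimes> P)"
    using P(1,2) A by (simp only: m_assoc m_closed)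
  then have "A = Q \<otimes> U \<otimes> P \<oplus> Q \<otimes> X \<otimes> P"
    using P A U(1) X(1) by (simp add: AUX l_distr r_distr)
  moreover have "(Q \<otimes> U \<otimes> P) [^] m = e"
  proof -
    have "Q \<otimes> e \<otimes> P = e \<otimes> (Q \<otimes> P)" using P(1,2) e(1) by (simp only: e(3)[symmetric] m_assoc)
    then show ?thesis using U e(1) P conj_pow[OF P U(1)] by simp
  qed
  moreover have "(Q \<otimes> X \<otimes> P) [^] k = \<zero>" using X P conj_pow[OF P X(1)] by simp
  ultimately show ?thesis
    unfolding fine_in_def using U X P corner[OF U(1-3)] corner[OF X(1-3)]
    by (intro bexI[of _ "Q \<otimes> U \<otimes> P"] bexI[of _ "Q \<otimes> X \<otimes> P"]) auto
qed

section \<open>Peirce components and block triangular elements\<close>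

lemma corner_mult_zero:
  assumes "x \<in> carrier R" "y \<in> carrier R" "e \<in> carrier R" "f \<in> carrier R"
    "x \<otimes> e = x" "f \<otimes> y = y" "e \<otimes> f = \<zero>"
  shows "x \<otimes> y = \<zero>"
proof -
  have "x \<otimes> y = (x \<otimes> e) \<otimes> (f \<otimes> y)" by (simp only: assms)
  also have "\<dots> = x \<otimes> (e \<otimes> f) \<otimes> y" using assms(1-4) by (simp only: m_assoc m_closed)
  finally show ?thesis using assms by simp
qed

lemma corner_pow:
  assumes "x \<in> carrier R" "e \<in> carrier R" "e \<otimes> x = x" "x \<otimes> e = x"
  shows "e \<otimes> x [^] Suc k = x [^] Suc k" "x [^] Suc k \<otimes> e = x [^] Suc k"
  using assms by (simp_all only: nat_pow_Suc2 nat_pow_closed m_assoc[symmetric])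
    (simp_all only: nat_pow_Suc2[symmetric] nat_pow_Suc nat_pow_closed m_assoc)

lemma idempotent_pow:
  assumes "e \<in> carrier R" "e \<otimes> e = e" "n \<ge> 1"
  shows "e [^] (n::nat) = e"
  using assms(3) by (induction n rule: dec_induct) (use assms in simp_all)

text \<open>The exponent \<open>m * n\<close> serves both elements because \<open>e\<close> and
  \<open>f\<close> are idempotent. The form \<open>Suc l\<close> avoids the power 0, which would be
  \<open>1\<close> instead of the corner identity.\<close>

lemma corner_torsion_common:
  assumes "x \<in> carrier R" "y \<in> carrier R" "e \<in> carrier R" "f \<in> carrier R" "e \<otimes> e = e" "f \<otimes> f = f"
    "(m::nat) \<ge> 1" "x [^] m = e" "(n::nat) \<ge> 1" "y [^] n = f"
  obtains l where "x [^] Suc l = e" "y [^] Suc l = f"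
proof -
  have "x [^] (m * n) = e" using assms idempotent_pow by (simp flip: nat_pow_pow)
  moreover have "y [^] (n * m) = f" using assms idempotent_pow by (simp flip: nat_pow_pow)
  moreover obtain l where "m * n = Suc l" using assms(7,9) by (cases "m * n") auto
  ultimately show thesis using that[of l] by (simp only: mult.commute)
qed

text \<open>In block form \<open>A\<close> has rows \<open>u, h\<close> and \<open>g, V + Y\<close>.
  The lower triangular part \<open>u + V + g\<close> is the torsion unit: a power of it has identity
  diagonal blocks, and the \<open>c\<close>-th power of that clears the corner. The rest
  \<open>h + Y\<close> inherits nilpotency from \<open>Y\<close>.\<close>

lemma fine_in_block:
  assumes c: "[(c::nat)] \<cdot> \<one> = \<zero>" "c \<ge> 1"
    and e: "e \<in> carrier R" "e \<otimes> e = e" and f: "f \<in> carrier R" "f \<otimes> f = f"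
    and ef: "e \<otimes> f = \<zero>" "f \<otimes> e = \<zero>"
    and A: "A \<in> carrier R" "(e \<oplus> f) \<otimes> A = A" "A \<otimes> (e \<oplus> f) = A"
    and u: "(m::nat) \<ge> 1" "(e \<otimes> A \<otimes> e) [^] m = e"
    and fine: "fine_in R f (f \<otimes> A \<otimes> f)"
  shows "fine_in R (e \<oplus> f) A"
proof -
  obtain V Y n k where V: "V \<in> carrier R" "f \<otimes> V = V" "V \<otimes> f = V" "n \<ge> (1::nat)" "V [^] n = f"
    and Y: "Y \<in> carrier R" "f \<otimes> Y = Y" "Y \<otimes> f = Y" "Y [^] (k::nat) = \<zero>"
    and AVY: "f \<otimes> A \<otimes> f = V \<oplus> Y"
    using fine unfolding fine_in_def by metis
  define u where "u = e \<otimes> A \<otimes> e"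
  define g where "g = f \<otimes> A \<otimes> e"
  define h where "h = e \<otimes> A \<otimes> f"
  have u: "u \<in> carrier R" "e \<otimes> u = u" "u \<otimes> e = u"
    using e A(1) by (auto simp: u_def m_assoc) (simp add: m_assoc[symmetric])
  have g: "g \<in> carrier R" "f \<otimes> g = g" "g \<otimes> e = g"
    using e f A(1) by (auto simp: g_def m_assoc) (simp add: m_assoc[symmetric])
  have h: "h \<in> carrier R" "e \<otimes> h = h" "h \<otimes> f = h"
    using e f A(1) by (auto simp: h_def m_assoc) (simp add: m_assoc[symmetric])
  note z1 = corner_mult_zero[OF _ _ e(1) f(1) _ _ ef(1)]
  note z2 = corner_mult_zero[OF _ _ f(1) e(1) _ _ ef(2)]
  have "A = (e \<oplus> f) \<otimes> A \<otimes> (e \<oplus> f)" using A by simp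
  also have "\<dots> = u \<oplus> h \<oplus> (g \<oplus> f \<otimes> A \<otimes> f)"
    using e(1) f(1) A(1) by (simp add: u_def g_def h_def l_distr r_distr a_ac)
  finally have AUX: "A = (u \<oplus> V \<oplus> g) \<oplus> (h \<oplus> Y)"
    using u(1) g(1) h(1) V(1) Y(1) by (simp add: AVY a_ac)
  \<comment> \<open>Powers of a block lower triangular element have the powers of the blocks on the
    diagonal; of the lower left block \<open>g'\<close> only its position matters.\<close>
  have pow: "\<exists>g'\<in>carrier R. f \<otimes> g' = g' \<and> g' \<otimes> e = g' \<and>
      (u \<oplus> V \<oplus> g) [^] Suc l = u [^] Suc l \<oplus> V [^] Suc l \<oplus> g'" for l
  proof (induction l)
    case 0
    show ?case using u V g by (intro bexI[of _ g]) auto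
  next
    case (Suc l)
    then obtain g' where g': "g' \<in> carrier R" "f \<otimes> g' = g'" "g' \<otimes> e = g'"
      "(u \<oplus> V \<oplus> g) [^] Suc l = u [^] Suc l \<oplus> V [^] Suc l \<oplus> g'" by blast
    define x where "x = u [^] Suc l"
    define y where "y = V [^] Suc l"
    have x: "x \<in> carrier R" "e \<otimes> x = x" "x \<otimes> e = x"
      using u e(1) corner_pow[of u e l] by (simp_all only: x_def nat_pow_closed)
    have y: "y \<in> carrier R" "f \<otimes> y = y" "y \<otimes> f = y"
      using V f(1) corner_pow[of V f l] by (simp_all only: y_def nat_pow_closed)
    have z: "x \<otimes> V = \<zero>" "x \<otimes> g = \<zero>" "y \<otimes> u = \<zero>" "g' \<otimes> V = \<zero>" "g' \<otimes> g = \<zero>"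
      using x y g' u V g by (auto intro: z1 z2)
    have "(u \<oplus> V \<oplus> g) [^] Suc (Suc l) = (x \<oplus> y \<oplus> g') \<otimes> (u \<oplus> V \<oplus> g)"
      unfolding nat_pow_Suc[of _ "Suc l"] g'(4) x_def y_def ..
    also have "\<dots> = x \<otimes> u \<oplus> y \<otimes> V \<oplus> (y \<otimes> g \<oplus> g' \<otimes> u)"
      using x(1) y(1) g'(1) u(1) V(1) g(1) by (simp add: l_distr r_distr z a_ac)
    finally have "(u \<oplus> V \<oplus> g) [^] Suc (Suc l) = u [^] Suc (Suc l) \<oplus> V [^] Suc (Suc l) \<oplus> (y \<otimes> g \<oplus> g' \<otimes> u)"
      unfolding nat_pow_Suc[of _ "Suc l"] x_def y_def .
    moreover have "f \<otimes> (y \<otimes> g \<oplus> g' \<otimes> u) = y \<otimes> g \<oplus> g' \<otimes> u"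
      using y g' u g f(1) by (simp add: r_distr m_assoc[symmetric])
    moreover have "(y \<otimes> g \<oplus> g' \<otimes> u) \<otimes> e = y \<otimes> g \<oplus> g' \<otimes> u"
      using y g' u g e(1) by (simp add: l_distr m_assoc)
    moreover have "y \<otimes> g \<oplus> g' \<otimes> u \<in> carrier R" using y g' u g by simp
    ultimately show ?case by blast
  qed
  have "u [^] m = e" using assms by (simp add: u_def)
  then obtain l where l: "u [^] Suc l = e" "V [^] Suc l = f"
    using corner_torsion_common[OF u(1) V(1) e(1) f(1) e(2) f(2)] \<open>m \<ge> 1\<close> V(4,5) by metis
  obtain g' where g': "g' \<in> carrier R" "f \<otimes> g' = g'" "g' \<otimes> e = g'"
    "(u \<oplus> V \<oplus> g) [^] Suc l = e \<oplus> f \<oplus> g'" using pow[of l] l by metis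
  \<comment> \<open>The block \<open>g'\<close> squares to zero, so powers grow linearly in
    \<open>g'\<close> and the \<open>c\<close>-th one removes it.\<close>
  have unip: "(e \<oplus> f \<oplus> g') [^] Suc k = e \<oplus> f \<oplus> [(Suc k)] \<cdot> g'" for k :: nat
  proof (induction k)
    case 0
    show ?case using e f g' by simp
  next
    case (Suc k)
    have z: "e \<otimes> g' = \<zero>" "g' \<otimes> f = \<zero>" "g' \<otimes> g' = \<zero>"
      using e f g' by (auto intro: z1 z2)
    have "(e \<oplus> f \<oplus> g') [^] Suc (Suc k) = (e \<oplus> f \<oplus> [(Suc k)] \<cdot> g') \<otimes> (e \<oplus> f \<oplus> g')"
      unfolding nat_pow_Suc[of _ "Suc k"] Suc.IH ..
    also have "\<dots> = e \<oplus> f \<oplus> ([(Suc k)] \<cdot> g' \<oplus> g')"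
      using e f g' by (simp add: l_distr r_distr z ef add_pow_ldistr a_ac del: add.nat_pow_Suc)
    also have "[(Suc k)] \<cdot> g' \<oplus> g' = [(Suc (Suc k))] \<cdot> g'" using g' by simp
    finally show ?case .
  qed
  obtain c' where c': "c = Suc c'" using c(2) by (cases c) auto
  have "[c] \<cdot> g' = \<zero>" using add_pow_one_mult(1)[OF g'(1), of c] c g'(1) by simp
  then have "(e \<oplus> f \<oplus> g') [^] c = e \<oplus> f"
    using unip[of c'] e(1) f(1) unfolding c' by simp
  then have tors: "(u \<oplus> V \<oplus> g) [^] (Suc l * c) = e \<oplus> f"
    using u V g g'(4) by (simp only: nat_pow_pow[symmetric] a_closed)
  \<comment> \<open>Both \<open>h h\<close> and \<open>Y h\<close> vanish, so a left factor
    \<open>h + Y\<close> followed by another acts on it as \<open>Y\<close>; iterating gives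
    \<open>(h + Y)^(l+1) = (h + Y) Y^l\<close>.\<close>
  have XX: "(h \<oplus> Y) \<otimes> (h \<oplus> Y) = (h \<oplus> Y) \<otimes> Y"
  proof -
    have "h \<otimes> h = \<zero>" "Y \<otimes> h = \<zero>" using h Y by (auto intro: z2)
    then show ?thesis using h(1) Y(1) by (simp add: l_distr r_distr)
  qed
  have "(h \<oplus> Y) [^] Suc l = (h \<oplus> Y) \<otimes> Y [^] l" for l :: nat
  proof (induction l)
    case (Suc l)
    have "(h \<oplus> Y) [^] Suc (Suc l) = ((h \<oplus> Y) \<otimes> (h \<oplus> Y)) \<otimes> Y [^] l"
      using h(1) Y(1) by (simp only: nat_pow_Suc2[of _ "Suc l"] Suc.IH a_closed m_assoc nat_pow_closed)
    also have "\<dots> = (h \<oplus> Y) \<otimes> Y [^] Suc l"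
      unfolding XX using h(1) Y(1) by (simp only: nat_pow_Suc2 a_closed m_assoc nat_pow_closed)
    finally show ?case .
  qed (use h Y in simp)
  then have nil: "(h \<oplus> Y) [^] Suc k = \<zero>" using Y h by simp
  have z: "e \<otimes> V = \<zero>" "e \<otimes> g = \<zero>" "f \<otimes> u = \<zero>" "u \<otimes> f = \<zero>" "V \<otimes> e = \<zero>" "g \<otimes> f = \<zero>"
    "e \<otimes> Y = \<zero>" "f \<otimes> h = \<zero>" "h \<otimes> e = \<zero>" "Y \<otimes> e = \<zero>"
    using e f u V g h Y by (auto intro: z1 z2)
  have cor: "(e \<oplus> f) \<otimes> (u \<oplus> V \<oplus> g) = u \<oplus> V \<oplus> g" "(u \<oplus> V \<oplus> g) \<otimes> (e \<oplus> f) = u \<oplus> V \<oplus> g"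
    "(e \<oplus> f) \<otimes> (h \<oplus> Y) = h \<oplus> Y" "(h \<oplus> Y) \<otimes> (e \<oplus> f) = h \<oplus> Y"
    using e(1) f(1) u V g h Y by (simp_all add: l_distr r_distr z a_ac)
  show ?thesis
    unfolding fine_in_def
  proof (intro bexI conjI)
    show "\<exists>m\<ge>1::nat. (u \<oplus> V \<oplus> g) [^] m = e \<oplus> f"
      using tors c by (intro exI[of _ "Suc l * c"]) simp
    show "\<exists>k::nat. (h \<oplus> Y) [^] k = \<zero>" using nil by blast
  qed (use AUX cor u V g h Y in simp_all)
qed

end

section \<open>Matrix units and transvections\<close>

definition mat_unit :: "nat \<Rightarrow> ('a, 'm) ring_scheme \<Rightarrow> nat \<Rightarrow> nat \<Rightarrow> 'a \<Rightarrow> 'a mat" where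
  "mat_unit n R k l x = mat n n (\<lambda>(i, j). if i = k \<and> j = l then x else \<zero>\<^bsub>R\<^esub>)"

definition mat_idem :: "nat \<Rightarrow> ('a, 'm) ring_scheme \<Rightarrow> nat set \<Rightarrow> 'a mat" where
  "mat_idem n R I = mat n n (\<lambda>(i, j). if i = j \<and> i \<in> I then \<one>\<^bsub>R\<^esub> else \<zero>\<^bsub>R\<^esub>)"

locale matrix_ring_over = ring R for R (structure) +
  fixes n :: nat
begin

abbreviation "M \<equiv> matrix_ring n R"
abbreviation "E \<equiv> mat_unit n R"
abbreviation "idem \<equiv> mat_idem n R"

sublocale M: ring M
  by (rule matrix_ring_is_ring) (rule ring_axioms)

lemma M_dims: "A \<in> carrier M \<Longrightarrow> dim_row A = n" "A \<in> carrier M \<Longrightarrow> dim_col A = n"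
  by (auto simp: matrix_ring_def)

lemma mat_closed: "(\<And>i j. i < n \<Longrightarrow> j < n \<Longrightarrow> f (i, j) \<in> carrier R) \<Longrightarrow> mat n n f \<in> carrier M"
  by (simp add: matrix_ring_def)

lemma entry_closed [simp, intro]: "A \<in> carrier M \<Longrightarrow> i < n \<Longrightarrow> j < n \<Longrightarrow> A $$ (i, j) \<in> carrier R"
  by (simp add: matrix_ring_def)

lemma M_eqI:
  assumes "A \<in> carrier M" "B \<in> carrier M" "\<And>i j. i < n \<Longrightarrow> j < n \<Longrightarrow> A $$ (i, j) = B $$ (i, j)"
  shows "A = B"
  using assms(3) M_dims[OF assms(1)] M_dims[OF assms(2)] by (intro eq_matI) simp_all

lemma E_closed [simp, intro]: "x \<in> carrier R \<Longrightarrow> E k l x \<in> carrier M"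
  by (simp add: mat_unit_def mat_closed)

lemma idem_closed [simp, intro]: "idem I \<in> carrier M"
  by (simp add: mat_idem_def mat_closed)

lemma add_entry [simp]: "i < n \<Longrightarrow> j < n \<Longrightarrow> (A \<oplus>\<^bsub>M\<^esub> B) $$ (i, j) = A $$ (i, j) \<oplus> B $$ (i, j)"
  and one_entry [simp]: "i < n \<Longrightarrow> j < n \<Longrightarrow> \<one>\<^bsub>M\<^esub> $$ (i, j) = (if i = j then \<one> else \<zero>)"
  and zero_entry [simp]: "i < n \<Longrightarrow> j < n \<Longrightarrow> \<zero>\<^bsub>M\<^esub> $$ (i, j) = \<zero>"
  and E_entry: "i < n \<Longrightarrow> j < n \<Longrightarrow> E k l x $$ (i, j) = (if i = k \<and> j = l then x else \<zero>)"
  and idem_entry: "i < n \<Longrightarrow> j < n \<Longrightarrow> idem I $$ (i, j) = (if i = j \<and> i \<in> I then \<one> else \<zero>)"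
  and mult_entry: "i < n \<Longrightarrow> j < n \<Longrightarrow>
    (A \<otimes>\<^bsub>M\<^esub> B) $$ (i, j) = (\<Oplus>k\<in>{..<n}. A $$ (i, k) \<otimes> B $$ (k, j))"
  unfolding matrix_ring_def mat_unit_def mat_idem_def by simp_all

lemma uminus_entry [simp]:
  assumes "A \<in> carrier M" "i < n" "j < n"
  shows "(\<ominus>\<^bsub>M\<^esub> A) $$ (i, j) = \<ominus> A $$ (i, j)"
proof -
  have "A $$ (i, j) \<oplus> (\<ominus>\<^bsub>M\<^esub> A) $$ (i, j) = \<zero>"
    using assms add_entry[of i j A "\<ominus>\<^bsub>M\<^esub> A"] by (simp add: M.r_neg del: add_entry)
  then show ?thesis using assms by (metis M.a_inv_closed a_comm entry_closed minus_equality)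
qed

lemma E_mult_entry:
  assumes "x \<in> carrier R" "A \<in> carrier M" "i < n" "j < n" "l < n"
  shows "(E k l x \<otimes>\<^bsub>M\<^esub> A) $$ (i, j) = (if i = k then x \<otimes> A $$ (l, j) else \<zero>)"
proof -
  have "(E k l x \<otimes>\<^bsub>M\<^esub> A) $$ (i, j) = (\<Oplus>r\<in>{..<n}. if l = r then (if i = k then x \<otimes> A $$ (r, j) else \<zero>) else \<zero>)"
    using assms unfolding mult_entry[OF assms(3,4)] by (intro finsum_cong') (auto simp: E_entry)
  also have "\<dots> = (if i = k then x \<otimes> A $$ (l, j) else \<zero>)"
    using assms by (intro add.finprod_singleton) auto
  finally show ?thesis .
qed

lemma mult_E_entry:
  assumes "x \<in> carrier R" "A \<in> carrier M" "i < n" "j < n" "k < n"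
  shows "(A \<otimes>\<^bsub>M\<^esub> E k l x) $$ (i, j) = (if j = l then A $$ (i, k) \<otimes> x else \<zero>)"
proof -
  have "(A \<otimes>\<^bsub>M\<^esub> E k l x) $$ (i, j) = (\<Oplus>r\<in>{..<n}. if k = r then (if j = l then A $$ (i, r) \<otimes> x else \<zero>) else \<zero>)"
    using assms unfolding mult_entry[OF assms(3,4)] by (intro finsum_cong') (auto simp: E_entry)
  also have "\<dots> = (if j = l then A $$ (i, k) \<otimes> x else \<zero>)"
    using assms by (intro add.finprod_singleton) auto
  finally show ?thesis .
qed

lemma idem_mult_entry:
  assumes "A \<in> carrier M" "i < n" "j < n"
  shows "(idem I \<otimes>\<^bsub>M\<^esub> A) $$ (i, j) = (if i \<in> I then A $$ (i, j) else \<zero>)"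
proof -
  have "(idem I \<otimes>\<^bsub>M\<^esub> A) $$ (i, j) = (\<Oplus>r\<in>{..<n}. if i = r then (if r \<in> I then A $$ (r, j) else \<zero>) else \<zero>)"
    using assms unfolding mult_entry[OF assms(2,3)] by (intro finsum_cong') (auto simp: idem_entry)
  also have "\<dots> = (if i \<in> I then A $$ (i, j) else \<zero>)"
    using assms by (intro add.finprod_singleton) auto
  finally show ?thesis .
qed

lemma mult_idem_entry:
  assumes "A \<in> carrier M" "i < n" "j < n"
  shows "(A \<otimes>\<^bsub>M\<^esub> idem I) $$ (i, j) = (if j \<in> I then A $$ (i, j) else \<zero>)"
proof -
  have "(A \<otimes>\<^bsub>M\<^esub> idem I) $$ (i, j) = (\<Oplus>r\<in>{..<n}. if j = r then (if r \<in> I then A $$ (i, r) else \<zero>) else \<zero>)"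
    using assms unfolding mult_entry[OF assms(2,3)] by (intro finsum_cong') (auto simp: idem_entry)
  also have "\<dots> = (if j \<in> I then A $$ (i, j) else \<zero>)"
    using assms by (intro add.finprod_singleton) auto
  finally show ?thesis .
qed

lemma E_mult_E:
  assumes "x \<in> carrier R" "y \<in> carrier R" "k < n" "l < n" "r < n" "s < n"
  shows "E k l x \<otimes>\<^bsub>M\<^esub> E r s y = (if l = r then E k s (x \<otimes> y) else \<zero>\<^bsub>M\<^esub>)"
  using assms by (intro M_eqI) (auto simp: E_mult_entry E_entry)

lemma E_zero: "E k l \<zero> = \<zero>\<^bsub>M\<^esub>"
  by (intro M_eqI) (auto simp: E_entry)

lemma E_add: "x \<in> carrier R \<Longrightarrow> y \<in> carrier R \<Longrightarrow> E k l x \<oplus>\<^bsub>M\<^esub> E k l y = E k l (x \<oplus> y)"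
  by (intro M_eqI) (auto simp: E_entry)

lemma add_pow_one_M:
  assumes "[(c::nat)] \<cdot> \<one> = \<zero>"
  shows "[c] \<cdot>\<^bsub>M\<^esub> \<one>\<^bsub>M\<^esub> = \<zero>\<^bsub>M\<^esub>"
proof -
  have "([k] \<cdot>\<^bsub>M\<^esub> \<one>\<^bsub>M\<^esub>) $$ (i, j) = (if i = j then [k] \<cdot> \<one> else \<zero>)" if "i < n" "j < n" for i j and k :: nat
    by (induction k) (use that in auto)
  then show ?thesis using assms by (intro M_eqI) auto
qed

lemma E_diag_pow:
  assumes "x \<in> carrier R" "i < n"
  shows "E i i x [^]\<^bsub>M\<^esub> Suc k = E i i (x [^] Suc k)"
proof (induction k)
  case (Suc k)
  show ?case
    unfolding M.nat_pow_Suc[of _ "Suc k"] Suc nat_pow_Suc[of _ "Suc k"]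
    using assms by (simp only: E_mult_E nat_pow_closed if_True simp_thms)
qed (use assms in simp)

lemma E_diag2_pow:
  assumes "x \<in> carrier R" "y \<in> carrier R" "i < n" "j < n" "i \<noteq> j"
  shows "(E i i x \<oplus>\<^bsub>M\<^esub> E j j y) [^]\<^bsub>M\<^esub> Suc k = E i i (x [^] Suc k) \<oplus>\<^bsub>M\<^esub> E j j (y [^] Suc k)"
proof (induction k)
  case (Suc k)
  show ?case
    unfolding M.nat_pow_Suc[of _ "Suc k"] Suc nat_pow_Suc[of _ "Suc k"]
    using assms by (simp add: E_mult_E M.l_distr M.r_distr del: nat_pow_Suc M.nat_pow_Suc)
qed (use assms in simp)

lemma idem_single: "E i i \<one> = idem {i}"
  by (intro M_eqI) (auto simp: E_entry idem_entry)

lemma idem_mult_idem: "idem I \<otimes>\<^bsub>M\<^esub> idem J = idem (I \<inter> J)"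
  by (intro M_eqI) (auto simp: idem_mult_entry idem_entry)

lemma idem_empty: "idem {} = \<zero>\<^bsub>M\<^esub>"
  by (intro M_eqI) (auto simp: idem_entry)

lemma idem_add_idem: "I \<inter> J = {} \<Longrightarrow> idem I \<oplus>\<^bsub>M\<^esub> idem J = idem (I \<union> J)"
  by (intro M_eqI) (auto simp: idem_entry)

lemma idem_full: "idem {..<n} = \<one>\<^bsub>M\<^esub>"
  by (intro M_eqI) (auto simp: idem_entry)

section \<open>Corners on index sets and conjugation by transvections\<close>

definition corner :: "nat set \<Rightarrow> 'a mat \<Rightarrow> bool" where
  "corner I A \<longleftrightarrow> A \<in> carrier M \<and> idem I \<otimes>\<^bsub>M\<^esub> A = A \<and> A \<otimes>\<^bsub>M\<^esub> idem I = A"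

lemma corner_iff:
  "corner I A \<longleftrightarrow> A \<in> carrier M \<and> (\<forall>i<n. \<forall>j<n. A $$ (i, j) \<noteq> \<zero> \<longrightarrow> i \<in> I \<and> j \<in> I)"
proof
  assume c: "corner I A"
  have "i \<in> I \<and> j \<in> I" if "i < n" "j < n" "A $$ (i, j) \<noteq> \<zero>" for i j
    using c that idem_mult_entry[of A i j I] mult_idem_entry[of A i j I]
    by (auto simp: corner_def split: if_splits)
  then show "A \<in> carrier M \<and> (\<forall>i<n. \<forall>j<n. A $$ (i, j) \<noteq> \<zero> \<longrightarrow> i \<in> I \<and> j \<in> I)"
    using c by (auto simp: corner_def)
next
  assume "A \<in> carrier M \<and> (\<forall>i<n. \<forall>j<n. A $$ (i, j) \<noteq> \<zero> \<longrightarrow> i \<in> I \<and> j \<in> I)"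
  then show "corner I A"
    unfolding corner_def by (intro conjI M_eqI) ((auto simp: idem_mult_entry mult_idem_entry; metis)+)
qed

definition transvection :: "nat \<Rightarrow> nat \<Rightarrow> 'a \<Rightarrow> 'a mat" where
  "transvection k l x = \<one>\<^bsub>M\<^esub> \<oplus>\<^bsub>M\<^esub> E k l x"

lemma transvection_closed [simp]: "x \<in> carrier R \<Longrightarrow> transvection k l x \<in> carrier M"
  by (simp add: transvection_def)

lemma transvection_inverse:
  assumes "x \<in> carrier R" "k < n" "l < n" "k \<noteq> l"
  shows "transvection k l x \<otimes>\<^bsub>M\<^esub> transvection k l (\<ominus> x) = \<one>\<^bsub>M\<^esub>"
proof -
  have "E k l x \<oplus>\<^bsub>M\<^esub> E k l (\<ominus> x) = \<zero>\<^bsub>M\<^esub>" using assms by (simp add: E_add r_neg E_zero)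
  then show ?thesis
    using assms by (simp add: transvection_def M.l_distr M.r_distr E_mult_E M.a_assoc)
qed

lemma transvection_idem:
  assumes "x \<in> carrier R" "k \<in> I" "l \<in> I"
  shows "idem I \<otimes>\<^bsub>M\<^esub> transvection k l x = transvection k l x \<otimes>\<^bsub>M\<^esub> idem I"
  using assms by (intro M_eqI) (auto simp: idem_mult_entry mult_idem_entry transvection_def E_entry)

text \<open>The local \<open>B\<close> is row \<open>i\<close> after the row operation adding
  \<open>x\<close> times row \<open>l\<close> to row \<open>k\<close>. The column operation,
  subtracting column \<open>k\<close> times \<open>x\<close> from column \<open>l\<close>, is then
  applied to it.\<close>

lemma transvection_conj_entry:
  assumes "x \<in> carrier R" "A \<in> carrier M" "i < n" "j < n" "k < n" "l < n"
  shows "(transvection k l x \<otimes>\<^bsub>M\<^esub> A \<otimes>\<^bsub>M\<^esub> transvection k l (\<ominus> x)) $$ (i, j) =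
    (let B = \<lambda>j. A $$ (i, j) \<oplus> (if i = k then x \<otimes> A $$ (l, j) else \<zero>)
     in B j \<oplus> (if j = l then \<ominus> (B k \<otimes> x) else \<zero>))"
proof -
  have B: "(transvection k l x \<otimes>\<^bsub>M\<^esub> A) $$ (i, j) = A $$ (i, j) \<oplus> (if i = k then x \<otimes> A $$ (l, j) else \<zero>)"
    if "j < n" for j
    using assms that by (simp add: transvection_def M.l_distr E_mult_entry)
  show ?thesis
    using assms
    by (simp add: transvection_def[of k l "\<ominus> x"] M.r_distr mult_E_entry B Let_def r_minus)
qed

end

section \<open>Matrices over torsion division rings\<close>

text \<open>Torsion makes every nonzero element invertible, so \<open>R\<close> is a division ring.
  The exponent \<open>c\<close> is what makes block triangular units torsion.\<close>

locale torsion_division_matrix_ring = matrix_ring_over R n for R (structure) and n +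
  fixes c :: nat
  assumes torsion: "a \<in> carrier R \<Longrightarrow> a \<noteq> \<zero> \<Longrightarrow> \<exists>m\<ge>1::nat. a [^] m = \<one>"
    and char: "c \<ge> 1" "[c] \<cdot> \<one> = \<zero>"
    and one_neq_zero: "\<one> \<noteq> \<zero>"
begin

lemma inverse_ex:
  assumes "a \<in> carrier R" "a \<noteq> \<zero>"
  obtains b where "b \<in> carrier R" "a \<otimes> b = \<one>" "b \<otimes> a = \<one>"
proof -
  obtain m where m: "m \<ge> (1::nat)" "a [^] m = \<one>" using torsion assms by metis
  obtain l where l: "m = Suc l" using m(1) by (cases m) auto
  show thesis
  proof (rule that)
    show "a [^] l \<in> carrier R" using assms by simp
    show "a \<otimes> a [^] l = \<one>" using m assms unfolding l by (simp only: nat_pow_Suc2)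
    show "a [^] l \<otimes> a = \<one>" using m assms unfolding l by (simp only: nat_pow_Suc)
  qed
qed

lemma mult_nonzero:
  assumes "a \<in> carrier R" "a \<noteq> \<zero>" "b \<in> carrier R" "b \<noteq> \<zero>"
  shows "a \<otimes> b \<noteq> \<zero>"
proof
  assume z: "a \<otimes> b = \<zero>"
  obtain a' where a': "a' \<in> carrier R" "a' \<otimes> a = \<one>" using inverse_ex assms by metis
  have "b = a' \<otimes> a \<otimes> b" using a' assms by simp
  also have "\<dots> = \<zero>" using z a'(1) assms by (simp only: m_assoc r_null)
  finally show False using assms by simp
qed

lemma E_torsion:
  assumes "a \<in> carrier R" "a \<noteq> \<zero>" "i < n"
  obtains m where "m \<ge> (1::nat)" "E i i a [^]\<^bsub>M\<^esub> m = idem {i}"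
proof -
  obtain m where m: "m \<ge> (1::nat)" "a [^] m = \<one>" using torsion assms by metis
  obtain l where l: "m = Suc l" using m(1) by (cases m) auto
  show thesis
    using that[of m] m E_diag_pow[OF assms(1,3), of l] unfolding l by (simp only: idem_single)
qed

lemma fine_one_by_one:
  assumes "corner {i} A" "i < n" "A $$ (i, i) \<noteq> \<zero>"
  shows "fine_in M (idem {i}) A"
proof -
  have A: "A \<in> carrier M" using assms(1) by (simp add: corner_def)
  have eq: "E i i (A $$ (i, i)) = A"
  proof (rule M_eqI)
    fix r s assume rs: "r < n" "s < n"
    show "E i i (A $$ (i, i)) $$ (r, s) = A $$ (r, s)"
    proof (cases "r = i \<and> s = i")
      case False
      then have "A $$ (r, s) = \<zero>" using assms(1) rs unfolding corner_iff by blast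
      with False rs show ?thesis by (auto simp: E_entry)
    qed (use rs in \<open>simp add: E_entry\<close>)
  qed (use A assms(2) in simp_all)
  obtain m where "m \<ge> (1::nat)" "E i i (A $$ (i, i)) [^]\<^bsub>M\<^esub> m = idem {i}"
    by (rule E_torsion[OF entry_closed[OF A assms(2,2)] assms(3,2)])
  then have "m \<ge> (1::nat)" "A [^]\<^bsub>M\<^esub> m = idem {i}" unfolding eq .
  moreover have "\<zero>\<^bsub>M\<^esub> [^]\<^bsub>M\<^esub> (1::nat) = \<zero>\<^bsub>M\<^esub>" by simp
  ultimately show ?thesis
    unfolding fine_in_def using assms(1) A
    by (intro bexI[of _ A] bexI[where x="\<zero>\<^bsub>M\<^esub>"] conjI exI[of _ m] exI[of _ "1::nat"])
      (simp_all add: corner_def)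
qed

text \<open>Here \<open>U\<close> has the same first row as \<open>A\<close> and its lower left entry is chosen
  so that \<open>U\<close> satisfies a twisted form of \<open>t\<^sup>2 - a t + a\<^sup>2 = 0\<close>;
  hence its cube is diagonal and \<open>U\<close> is torsion even over a noncommutative ring.\<close>

lemma fine_two_by_two:
  assumes A: "corner {i, j} A" and ij: "i < n" "j < n" "i \<noteq> j"
    and nz: "A $$ (i, i) \<noteq> \<zero>" "A $$ (i, j) \<noteq> \<zero>" and z: "A $$ (j, j) = \<zero>"
  shows "fine_in M (idem {i, j}) A"
proof -
  have AM: "A \<in> carrier M" using A by (simp add: corner_def)
  define a where "a = A $$ (i, i)"
  define b where "b = A $$ (i, j)"
  have ab: "a \<in> carrier R" "a \<noteq> \<zero>" "b \<in> carrier R" "b \<noteq> \<zero>"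
    using AM ij nz by (auto simp: a_def b_def)
  obtain b' where b': "b' \<in> carrier R" "b \<otimes> b' = \<one>" "b' \<otimes> b = \<one>"
    using inverse_ex ab by metis
  \<comment> \<open>The choice \<open>d = -b^-1 a^2\<close> makes \<open>a^2 + b d\<close> vanish.
    This is the \<open>(i, i)\<close> entry of \<open>U^2\<close>, and with \<open>d\<close> on its
    left it is the \<open>(j, i)\<close> entry of \<open>U^3\<close>.\<close>
  define d where "d = \<ominus> (b' \<otimes> (a \<otimes> a))"
  have d: "d \<in> carrier R" using ab b' by (simp add: d_def)
  have bd: "b \<otimes> d = \<ominus> (a \<otimes> a)"
    using ab b' by (simp add: d_def r_minus m_assoc[symmetric])
  have bd_nz: "b \<otimes> d \<noteq> \<zero>"
    unfolding bd using ab mult_nonzero[of a a] by (metis a_inv_closed m_closed minus_minus minus_zero)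
  have d_nz: "d \<noteq> \<zero>" using bd_nz ab by auto
  define x where "x = a \<otimes> (b \<otimes> d)"
  define y where "y = d \<otimes> (a \<otimes> b)"
  have xy: "x \<in> carrier R" "x \<noteq> \<zero>" "y \<in> carrier R" "y \<noteq> \<zero>"
    using ab d d_nz bd_nz mult_nonzero by (auto simp: x_def y_def)
  define U where "U = E i i a \<oplus>\<^bsub>M\<^esub> E i j b \<oplus>\<^bsub>M\<^esub> E j i d"
  define X where "X = E j i (A $$ (j, i) \<ominus> d)"
  have U: "U \<in> carrier M" using ab d by (simp add: U_def)
  have X: "X \<in> carrier M" using AM d ij by (simp add: X_def)
  note Es = E_mult_E M.l_distr M.r_distr
  have "U \<otimes>\<^bsub>M\<^esub> U = (E i i (a \<otimes> a) \<oplus>\<^bsub>M\<^esub> E i i (b \<otimes> d)) \<oplus>\<^bsub>M\<^esub>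
      (E i j (a \<otimes> b) \<oplus>\<^bsub>M\<^esub> E j i (d \<otimes> a) \<oplus>\<^bsub>M\<^esub> E j j (d \<otimes> b))"
    unfolding U_def using ab d ij by (simp add: Es M.a_ac)
  also have "E i i (a \<otimes> a) \<oplus>\<^bsub>M\<^esub> E i i (b \<otimes> d) = \<zero>\<^bsub>M\<^esub>"
    using ab d by (simp add: E_add bd r_neg E_zero)
  finally have U2: "U \<otimes>\<^bsub>M\<^esub> U = E i j (a \<otimes> b) \<oplus>\<^bsub>M\<^esub> E j i (d \<otimes> a) \<oplus>\<^bsub>M\<^esub> E j j (d \<otimes> b)"
    using ab d by simp
  have "U \<otimes>\<^bsub>M\<^esub> U \<otimes>\<^bsub>M\<^esub> U = E i i x \<oplus>\<^bsub>M\<^esub> E j j y \<oplus>\<^bsub>M\<^esub>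
      (E j i (d \<otimes> (a \<otimes> a)) \<oplus>\<^bsub>M\<^esub> E j i (d \<otimes> (b \<otimes> d)))"
    unfolding U2 unfolding U_def x_def y_def using ab d ij by (simp add: Es M.a_ac m_assoc)
  also have "E j i (d \<otimes> (a \<otimes> a)) \<oplus>\<^bsub>M\<^esub> E j i (d \<otimes> (b \<otimes> d)) = \<zero>\<^bsub>M\<^esub>"
    using ab d by (simp add: E_add bd r_minus r_neg E_zero)
  finally have U3: "U \<otimes>\<^bsub>M\<^esub> U \<otimes>\<^bsub>M\<^esub> U = E i i x \<oplus>\<^bsub>M\<^esub> E j j y"
    using xy by simp
  obtain k k' :: nat where k: "k \<ge> 1" "x [^] k = \<one>" "k' \<ge> 1" "y [^] k' = \<one>"
    using torsion xy by metis
  \<comment> \<open>Both corner identities are taken to be \<open>1\<close>, which gives one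
    exponent for the two diagonal entries of the cube.\<close>
  obtain l where l: "x [^] Suc l = \<one>" "y [^] Suc l = \<one>"
    using corner_torsion_common[OF xy(1,3) one_closed one_closed _ _ k] by auto
  have "(U [^]\<^bsub>M\<^esub> (3::nat)) [^]\<^bsub>M\<^esub> Suc l = E i i (x [^] Suc l) \<oplus>\<^bsub>M\<^esub> E j j (y [^] Suc l)"
    unfolding E_diag2_pow[OF xy(1,3) ij, symmetric] U3[symmetric] using U
    by (simp add: numeral_3_eq_3 del: M.nat_pow_Suc[of _ l])
  also have "\<dots> = idem {i, j}"
    unfolding l idem_single using ij(3) idem_add_idem[of "{i}" "{j}"] by (simp add: insert_commute)
  finally have tors: "U [^]\<^bsub>M\<^esub> (3 * Suc l) = idem {i, j}" using U by (simp only: M.nat_pow_pow)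
  have nil: "X [^]\<^bsub>M\<^esub> (2::nat) = \<zero>\<^bsub>M\<^esub>"
    using X AM d ij by (simp add: X_def numeral_2_eq_2 E_mult_E)
  have "corner {i, j} U" "corner {i, j} X"
    using U X ij ab d AM by (auto simp: corner_iff U_def X_def E_entry split: if_splits)
  moreover have "A = U \<oplus>\<^bsub>M\<^esub> X"
  proof (rule M_eqI)
    fix r s assume rs: "r < n" "s < n"
    have dd: "d \<oplus> (A $$ (j, i) \<ominus> d) = A $$ (j, i)"
      using d AM ij by (simp add: a_minus_def a_comm[of _ "\<ominus> d"] r_neg2)
    have "A $$ (r, s) = \<zero>" if "r \<notin> {i, j} \<or> s \<notin> {i, j}"
      using that A rs unfolding corner_iff by auto
    then show "A $$ (r, s) = (U \<oplus>\<^bsub>M\<^esub> X) $$ (r, s)"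
      using rs ij ab d AM z dd by (auto simp: U_def X_def E_entry a_def b_def)
  qed (use AM U X in auto)
  ultimately show ?thesis
    unfolding fine_in_def corner_def using tors nil
    by (intro bexI[of _ U] bexI[of _ X] conjI exI[of _ "3 * Suc l"] exI[of _ "2::nat"]) auto
qed

text \<open>The block decomposition is applied with a \<open>1 x 1\<close> first block, whose
  nonzero entry is torsion, and the complementary minor block as the second.\<close>

lemma fine_pivot:
  assumes A: "corner I A" and i: "i \<in> I" "i < n" "A $$ (i, i) \<noteq> \<zero>"
    and fine: "fine_in M (idem (I - {i})) (idem (I - {i}) \<otimes>\<^bsub>M\<^esub> A \<otimes>\<^bsub>M\<^esub> idem (I - {i}))"
  shows "fine_in M (idem I) A"
proof -
  have AM: "A \<in> carrier M" using A by (simp add: corner_def)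
  have I: "idem {i} \<oplus>\<^bsub>M\<^esub> idem (I - {i}) = idem I"
    using i(1) idem_add_idem[of "{i}" "I - {i}"] by (simp add: insert_absorb)
  have "idem {i} \<otimes>\<^bsub>M\<^esub> A \<otimes>\<^bsub>M\<^esub> idem {i} = E i i (A $$ (i, i))"
    using AM i by (intro M_eqI) (auto simp: mult_idem_entry idem_mult_entry E_entry)
  then obtain m where "m \<ge> (1::nat)" "(idem {i} \<otimes>\<^bsub>M\<^esub> A \<otimes>\<^bsub>M\<^esub> idem {i}) [^]\<^bsub>M\<^esub> m = idem {i}"
    using E_torsion[of "A $$ (i, i)" i] AM i by (metis entry_closed)
  then have "fine_in M (idem {i} \<oplus>\<^bsub>M\<^esub> idem (I - {i})) A"
    using AM A fine char add_pow_one_M[of c] unfolding corner_def I[symmetric]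
    by (intro M.fine_in_block[of c]) (auto simp: idem_mult_idem idem_empty)
  then show ?thesis unfolding I .
qed

section \<open>Reduction to a nonzero complementary block\<close>

definition conj_by :: "nat \<Rightarrow> nat \<Rightarrow> 'a \<Rightarrow> 'a mat \<Rightarrow> 'a mat" where
  "conj_by k l x A = transvection k l x \<otimes>\<^bsub>M\<^esub> A \<otimes>\<^bsub>M\<^esub> transvection k l (\<ominus> x)"

lemma conj_by_entry:
  assumes "x \<in> carrier R" "A \<in> carrier M" "i < n" "j < n" "k < n" "l < n"
  shows "i \<noteq> k \<Longrightarrow> j \<noteq> l \<Longrightarrow> conj_by k l x A $$ (i, j) = A $$ (i, j)"
    and "j \<noteq> l \<Longrightarrow> conj_by k l x A $$ (k, j) = A $$ (k, j) \<oplus> x \<otimes> A $$ (l, j)"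
    and "i \<noteq> k \<Longrightarrow> conj_by k l x A $$ (i, l) = A $$ (i, l) \<ominus> A $$ (i, k) \<otimes> x"
    and "conj_by k l x A $$ (k, l) = (A $$ (k, l) \<oplus> x \<otimes> A $$ (l, l)) \<ominus> (A $$ (k, k) \<oplus> x \<otimes> A $$ (l, k)) \<otimes> x"
  using assms transvection_conj_entry[OF assms(1,2)]
  by (simp_all add: conj_by_def Let_def a_minus_def)

text \<open>A transvection with both indices in \<open>I\<close> commutes with \<open>idem I\<close>
  and is invertible, so conjugating by it carries a nonzero counterexample on \<open>I\<close> to
  another one.\<close>

lemma conj_by_corner:
  assumes A: "corner I A" and kl: "k \<in> I" "l \<in> I" "k < n" "l < n" "k \<noteq> l" and x: "x \<in> carrier R"
  shows "corner I (conj_by k l x A)"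
    and "fine_in M (idem I) (conj_by k l x A) \<Longrightarrow> fine_in M (idem I) A"
    and "conj_by k l x A = \<zero>\<^bsub>M\<^esub> \<Longrightarrow> A = \<zero>\<^bsub>M\<^esub>"
proof -
  define P Q where "P = transvection k l x" and "Q = transvection k l (\<ominus> x)"
  note AM = A[unfolded corner_def, THEN conjunct1]
  have PQ: "P \<in> carrier M" "Q \<in> carrier M" "P \<otimes>\<^bsub>M\<^esub> Q = \<one>\<^bsub>M\<^esub>" "Q \<otimes>\<^bsub>M\<^esub> P = \<one>\<^bsub>M\<^esub>"
    using transvection_inverse[of x k l] transvection_inverse[of "\<ominus> x" k l] kl x
    by (simp_all add: P_def Q_def)
  have e: "idem I \<otimes>\<^bsub>M\<^esub> P = P \<otimes>\<^bsub>M\<^esub> idem I" "idem I \<otimes>\<^bsub>M\<^esub> Q = Q \<otimes>\<^bsub>M\<^esub> idem I"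
    using kl x by (simp_all add: P_def Q_def transvection_idem)
  have B: "conj_by k l x A = P \<otimes>\<^bsub>M\<^esub> A \<otimes>\<^bsub>M\<^esub> Q" by (simp only: conj_by_def P_def Q_def)
  have "idem I \<otimes>\<^bsub>M\<^esub> (P \<otimes>\<^bsub>M\<^esub> A \<otimes>\<^bsub>M\<^esub> Q) = P \<otimes>\<^bsub>M\<^esub> (idem I \<otimes>\<^bsub>M\<^esub> A) \<otimes>\<^bsub>M\<^esub> Q"
    using PQ(1,2) AM idem_closed[of I] e(1) by (metis M.m_assoc M.m_closed)
  moreover have "(P \<otimes>\<^bsub>M\<^esub> A \<otimes>\<^bsub>M\<^esub> Q) \<otimes>\<^bsub>M\<^esub> idem I = P \<otimes>\<^bsub>M\<^esub> (A \<otimes>\<^bsub>M\<^esub> idem I) \<otimes>\<^bsub>M\<^esub> Q"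
    using PQ(1,2) AM idem_closed[of I] e(2) by (metis M.m_assoc M.m_closed)
  ultimately show "corner I (conj_by k l x A)"
    using A PQ(1,2) unfolding corner_def B by simp
  show "fine_in M (idem I) A" if "fine_in M (idem I) (conj_by k l x A)"
    using that unfolding B by (intro M.fine_in_conj[OF PQ _ e AM]) auto
  have "Q \<otimes>\<^bsub>M\<^esub> (P \<otimes>\<^bsub>M\<^esub> A \<otimes>\<^bsub>M\<^esub> Q) \<otimes>\<^bsub>M\<^esub> P = (Q \<otimes>\<^bsub>M\<^esub> P) \<otimes>\<^bsub>M\<^esub> A \<otimes>\<^bsub>M\<^esub> (Q \<otimes>\<^bsub>M\<^esub> P)"
    using PQ(1,2) AM by (simp only: M.m_assoc M.m_closed)
  then show "A = \<zero>\<^bsub>M\<^esub>" if "conj_by k l x A = \<zero>\<^bsub>M\<^esub>"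
    using that PQ AM unfolding B by simp
qed

lemma uminus_nonzero: "a \<in> carrier R \<Longrightarrow> a \<noteq> \<zero> \<Longrightarrow> \<ominus> a \<noteq> \<zero>"
  using minus_minus[of a] minus_zero by metis

text \<open>Induction on the number of indices, by contradiction. Conjugation moves among
  counterexamples until one has a nonzero diagonal entry together with a nonzero entry outside its
  row and column, where the induction hypothesis applies.\<close>

lemma fine_corner:
  assumes "I \<subseteq> {..<n}" "corner I A" "A \<noteq> \<zero>\<^bsub>M\<^esub>"
  shows "fine_in M (idem I) A"
  using assms
proof (induction "card I" arbitrary: I A rule: less_induct)
  case less
  have lt: "i < n" if "i \<in> I" for i using that less.prems(1) by auto
  have "finite I" using less.prems(1) finite_subset by blast
  show ?case
  proof (rule ccontr)
    assume nf: "\<not> ?thesis"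
    define NF where "NF B \<longleftrightarrow> corner I B \<and> B \<noteq> \<zero>\<^bsub>M\<^esub> \<and> \<not> fine_in M (idem I) B" for B
    have NF_M: "B \<in> carrier M" if "NF B" for B using that by (simp add: NF_def corner_def)
    have NF_conj: "NF (conj_by k l x B)" if "NF B" "k \<in> I" "l \<in> I" "k \<noteq> l" "x \<in> carrier R" for k l x B
      using that conj_by_corner[of I B k l x] lt unfolding NF_def by blast
    have NF_E: "B $$ (i, j) \<in> carrier R" if "NF B" "i \<in> I" "j \<in> I" for B i j
      using that NF_M lt by simp
    \<comment> \<open>In a counterexample, a nonzero diagonal entry at \<open>i\<close> forces
      everything outside row \<open>i\<close> and column \<open>i\<close> to vanish; otherwise that
      smaller block is fine by induction and \<open>fine_pivot\<close> concludes.\<close>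
    have pivot: "B $$ (r, s) = \<zero>"
      if B: "NF B" and i: "i \<in> I" "B $$ (i, i) \<noteq> \<zero>" and rs: "r \<in> I" "s \<in> I" "r \<noteq> i" "s \<noteq> i" for B i r s
    proof (rule ccontr)
      assume nz: "B $$ (r, s) \<noteq> \<zero>"
      define C where "C = idem (I - {i}) \<otimes>\<^bsub>M\<^esub> B \<otimes>\<^bsub>M\<^esub> idem (I - {i})"
      have ent: "C $$ (u, v) = (if u \<in> I - {i} \<and> v \<in> I - {i} then B $$ (u, v) else \<zero>)"
        if "u < n" "v < n" for u v
        using that NF_M[OF B] by (auto simp: C_def mult_idem_entry idem_mult_entry)
      have "corner (I - {i}) C"
        unfolding corner_iff using ent NF_M[OF B] by (auto simp: C_def split: if_splits)
      moreover have "C \<noteq> \<zero>\<^bsub>M\<^esub>"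
        using ent[of r s] rs nz lt by auto
      moreover have "card (I - {i}) < card I" using \<open>finite I\<close> i by (intro psubset_card_mono) auto
      ultimately have "fine_in M (idem (I - {i})) C"
        using less.prems(1) by (intro less.hyps) auto
      then have "fine_in M (idem I) B"
        using B i lt unfolding C_def NF_def by (intro fine_pivot[of I B i]) auto
      then show False using B by (simp add: NF_def)
    qed
    have "NF A" using less.prems nf by (simp add: NF_def)
    have "\<exists>B i. NF B \<and> i \<in> I \<and> B $$ (i, i) \<noteq> \<zero>"
    proof -
      obtain i j where ij: "i < n" "j < n" "A $$ (i, j) \<noteq> \<zero>"
        using less.prems(3) NF_M[OF \<open>NF A\<close>] M_eqI[of A "\<zero>\<^bsub>M\<^esub>"] by auto
      then have I: "i \<in> I" "j \<in> I" using less.prems(2) unfolding corner_iff by auto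
      show ?thesis
      proof (cases "A $$ (i, i) \<noteq> \<zero> \<or> i = j")
        case True
        then show ?thesis using \<open>NF A\<close> I ij by blast
      next
        case False
        \<comment> \<open>Column \<open>j\<close> is subtracted from column \<open>i\<close>, which
          moves the nonzero entry \<open>(i, j)\<close> onto the diagonal up to sign.\<close>
        have "conj_by j i \<one> A $$ (i, i) = A $$ (i, i) \<ominus> A $$ (i, j) \<otimes> \<one>"
          using False ij NF_M[OF \<open>NF A\<close>] by (intro conj_by_entry(3)) auto
        also have "\<dots> = \<ominus> A $$ (i, j)" using False ij NF_M[OF \<open>NF A\<close>] by (simp add: a_minus_def)
        finally have "conj_by j i \<one> A $$ (i, i) \<noteq> \<zero>"
          using uminus_nonzero ij NF_M[OF \<open>NF A\<close>] by simp
        moreover have "NF (conj_by j i \<one> A)" using False I \<open>NF A\<close> by (intro NF_conj) auto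
        ultimately show ?thesis using I by blast
      qed
    qed
    then obtain B i where B: "NF B" and i: "i \<in> I" "B $$ (i, i) \<noteq> \<zero>" by blast
    have "I \<noteq> {i}"
      using B i lt fine_one_by_one[of i B] unfolding NF_def by blast
    then obtain j where j: "j \<in> I" "j \<noteq> i" using i by blast
    have "\<exists>B i j. NF B \<and> i \<in> I \<and> j \<in> I \<and> i \<noteq> j \<and> B $$ (i, i) \<noteq> \<zero> \<and> B $$ (i, j) \<noteq> \<zero>"
    proof (cases "B $$ (i, j) = \<zero>")
      case False
      then show ?thesis using B i j by blast
    next
      case ij: True
      have jj: "B $$ (j, j) = \<zero>" using pivot[OF B i j(1) j(1) j(2) j(2)] .
      note lt' = lt[OF i(1)] lt[OF j(1)] and BE = NF_E[OF B]
      note ent = conj_by_entry[OF _ NF_M[OF B]]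
      show ?thesis
      proof (cases "B $$ (j, i) = \<zero>")
        case True
        \<comment> \<open>Column \<open>i\<close> is subtracted from column \<open>j\<close>, which
          copies the diagonal entry to \<open>(i, j)\<close> with opposite sign.\<close>
        have "conj_by i j \<one> B $$ (i, i) = B $$ (i, i)"
          using ent(2)[of \<one> i i i j] lt' BE i j True by simp
        moreover have "conj_by i j \<one> B $$ (i, j) = \<ominus> B $$ (i, i)"
          using ent(4)[of \<one> i j i j] lt' BE i j True ij jj by (simp add: a_minus_def)
        ultimately show ?thesis
          using NF_conj[OF B i(1) j(1) j(2)[symmetric] one_closed] i j uminus_nonzero BE
          by (intro exI[of _ "conj_by i j \<one> B"] exI[of _ i] exI[of _ j]) simp
      next
        case False
        \<comment> \<open>The same conjugation makes the entry \<open>(j, j)\<close> nonzero and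
          preserves \<open>(j, i)\<close>, so \<open>i\<close> and \<open>j\<close> exchange
          roles.\<close>
        have "conj_by i j \<one> B $$ (j, j) = \<ominus> B $$ (j, i)"
          using ent(3)[of \<one> j j i j] lt' BE i j jj by (simp add: a_minus_def)
        moreover have "conj_by i j \<one> B $$ (j, i) = B $$ (j, i)"
          using ent(1)[of \<one> j i i j] lt' i j by simp
        ultimately show ?thesis
          using NF_conj[OF B i(1) j(1) j(2)[symmetric] one_closed] i j uminus_nonzero BE False
          by (intro exI[of _ "conj_by i j \<one> B"] exI[of _ j] exI[of _ i]) simp
      qed
    qed
    then obtain B i j where B: "NF B" and i: "i \<in> I" "B $$ (i, i) \<noteq> \<zero>"
      and j: "j \<in> I" "i \<noteq> j" "B $$ (i, j) \<noteq> \<zero>" by blast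
    \<comment> \<open>By \<open>pivot\<close> the entry \<open>(j, j)\<close> is zero, so two
      indices would be the case settled by \<open>fine_two_by_two\<close>. A third index is
      therefore available.\<close>
    have "I \<noteq> {i, j}"
      using B i j lt fine_two_by_two[of i j B] pivot[OF B i j(1,1)] unfolding NF_def by blast
    then obtain k where k: "k \<in> I" "k \<noteq> i" "k \<noteq> j" using i j by blast
    have "\<exists>B. NF B \<and> B $$ (i, i) \<noteq> \<zero> \<and> B $$ (i, j) \<noteq> \<zero> \<and> B $$ (i, k) = \<zero>"
    proof (cases "B $$ (i, k) = \<zero>")
      case True
      then show ?thesis using B i j by blast
    next
      case False
      obtain b where b: "b \<in> carrier R" "B $$ (i, j) \<otimes> b = \<one>"
        using inverse_ex[OF NF_E[OF B i(1) j(1)] j(3)] by metis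
      \<comment> \<open>With \<open>b\<close> inverse to the entry \<open>(i, j)\<close>,
        subtracting column \<open>j\<close> times \<open>x\<close> from column \<open>k\<close>
        clears \<open>(i, k)\<close>; the other entries of row \<open>i\<close> stay.\<close>
      define x where "x = b \<otimes> B $$ (i, k)"
      have x: "x \<in> carrier R" using b NF_E[OF B] i k by (simp add: x_def)
      note ent = conj_by_entry[OF x NF_M[OF B]] and l = lt[OF i(1)] lt[OF j(1)] lt[OF k(1)]
      have "B $$ (i, j) \<otimes> x = B $$ (i, k)"
        using b NF_E[OF B] i j k by (simp add: x_def m_assoc[symmetric])
      then have "conj_by j k x B $$ (i, k) = \<zero>"
        using ent(3)[of i k j k] l j k NF_E[OF B] i by (simp add: a_minus_def r_neg)
      moreover have "conj_by j k x B $$ (i, i) = B $$ (i, i)"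
        using ent(1)[of i i j k] l j k by simp
      moreover have "conj_by j k x B $$ (i, j) = B $$ (i, j)"
        using ent(1)[of i j j k] l j k by simp
      moreover have "NF (conj_by j k x B)" using NF_conj[OF B j(1) k(1) _ x] k by simp
      ultimately show ?thesis using i j by (intro exI[of _ "conj_by j k x B"]) simp
    qed
    then obtain C where C: "NF C" "C $$ (i, i) \<noteq> \<zero>" "C $$ (i, j) \<noteq> \<zero>" "C $$ (i, k) = \<zero>" by blast
    note ent = conj_by_entry[OF one_closed NF_M[OF C(1)]] and l = lt[OF i(1)] lt[OF j(1)] lt[OF k(1)]
    \<comment> \<open>Adding row \<open>i\<close> to row \<open>k\<close> makes
      \<open>(k, j)\<close> nonzero. The accompanying column operation leaves \<open>(i, i)\<close>
      intact because \<open>(i, k)\<close> was cleared, so \<open>pivot\<close> is violated.\<close>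
    have "conj_by k i \<one> C $$ (i, i) = C $$ (i, i)"
      using ent(3)[of i i k i] l k C(4) NF_E[OF C(1)] i by (simp add: a_minus_def)
    moreover have "conj_by k i \<one> C $$ (k, j) = C $$ (i, j)"
      using ent(2)[of i j k i] l k j i NF_E[OF C(1)] pivot[OF C(1) i(1) C(2) k(1) j(1)] by simp
    moreover have "NF (conj_by k i \<one> C)" using NF_conj[OF C(1) k(1) i(1)] k by simp
    ultimately show False using pivot[of "conj_by k i \<one> C" i k j] C i j k by simp
  qed
qed

end

section \<open>The radical of a matrix ring and lifting\<close>

context matrix_ring_over
begin

definition mats_over :: "'a set \<Rightarrow> 'a mat set" where
  "mats_over S = {A \<in> carrier M. \<forall>i<n. \<forall>j<n. A $$ (i, j) \<in> S}"

lemma mats_overD: "A \<in> mats_over S \<Longrightarrow> i < n \<Longrightarrow> j < n \<Longrightarrow> A $$ (i, j) \<in> S"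
  and mats_over_carrier: "A \<in> mats_over S \<Longrightarrow> A \<in> carrier M"
  by (simp_all add: mats_over_def)

lemma additive_subgroup_finsum_closed:
  assumes "additive_subgroup S R" "finite I" "\<And>i. i \<in> I \<Longrightarrow> f i \<in> S"
  shows "(\<Oplus>i\<in>I. f i) \<in> S"
proof -
  interpret S: additive_subgroup S R by fact
  show ?thesis using assms(2,3)
  proof (induction I)
    case (insert i I)
    then have "f \<in> I \<rightarrow> carrier R" "f i \<in> carrier R" using S.a_Hcarr by auto
    then show ?case using insert by simp
  qed simp
qed

lemma M_additive_subgroupI:
  assumes "S \<subseteq> carrier M" "\<zero>\<^bsub>M\<^esub> \<in> S" "\<And>A B. A \<in> S \<Longrightarrow> B \<in> S \<Longrightarrow> A \<oplus>\<^bsub>M\<^esub> B \<in> S"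
    "\<And>A. A \<in> S \<Longrightarrow> \<ominus>\<^bsub>M\<^esub> A \<in> S"
  shows "additive_subgroup S M"
  using assms by (intro additive_subgroup.intro M.add.subgroupI) (auto simp: a_inv_def)

lemma mats_over_ideal:
  assumes "ideal S R"
  shows "ideal (mats_over S) M"
proof -
  interpret S: ideal S R by fact
  have add: "additive_subgroup (mats_over S) M"
    by (rule M_additive_subgroupI) (auto simp: mats_over_def)
  have mult: "A \<otimes>\<^bsub>M\<^esub> B \<in> mats_over S"
    if "A \<in> carrier M" "B \<in> carrier M" "A \<in> mats_over S \<or> B \<in> mats_over S" for A B
  proof -
    have "A $$ (i, k) \<otimes> B $$ (k, j) \<in> S" if "i < n" "j < n" "k < n" for i j k
      using that \<open>A \<in> carrier M\<close> \<open>B \<in> carrier M\<close> \<open>A \<in> mats_over S \<or> B \<in> mats_over S\<close> mats_overD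
      by (metis S.I_l_closed S.I_r_closed entry_closed)
    then show ?thesis
      using that(1,2) unfolding mats_over_def
      by (auto simp: mult_entry intro!: additive_subgroup_finsum_closed S.is_additive_subgroup)
  qed
  show ?thesis
    by (intro ideal.intro ideal_axioms.intro add M.ring_axioms) (auto intro: mult dest: mats_over_carrier)
qed

text \<open>Only the finitely many entries of \<open>A\<close> matter: entries of \<open>A^L\<close>
  are sums of products of \<open>L\<close> of them, and a suitable \<open>L\<close> kills all such
  products.\<close>

lemma mats_over_locally_nilpotent:
  assumes "locally_nilpotent S R" "S \<subseteq> carrier R" "A \<in> mats_over S"
  shows "\<exists>k::nat. A [^]\<^bsub>M\<^esub> k = \<zero>\<^bsub>M\<^esub>"
proof -
  define F where "F = (\<lambda>(i, j). A $$ (i, j)) ` ({..<n} \<times> {..<n})"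
  have F: "finite F" "F \<subseteq> S" using assms(3) by (auto simp: F_def mats_over_def)
  then obtain L where L: "\<And>xs. set xs \<subseteq> F \<Longrightarrow> length xs = L \<Longrightarrow> foldr (\<otimes>) xs \<one> = \<zero>"
    using assms(1) unfolding locally_nilpotent_def by metis
  have A: "A \<in> carrier M" using assms(3) by (rule mats_over_carrier)
  have prod: "foldr (\<otimes>) xs \<one> \<in> carrier R" if "set xs \<subseteq> F" for xs
    using that F(2) assms(2) by (induction xs) auto
  \<comment> \<open>The trailing word \<open>xs\<close> stores factors already peeled off: each step
    moves one entry of \<open>A\<close> from the power into the word, until the word has length
    \<open>L\<close>. The empty word gives the claim.\<close>
  have "(A [^]\<^bsub>M\<^esub> k) $$ (i, j) \<otimes> foldr (\<otimes>) xs \<one> = \<zero>"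
    if "i < n" "j < n" "set xs \<subseteq> F" "length xs + k = L" for i j k xs
    using that
  proof (induction k arbitrary: j xs)
    case 0
    then show ?case using L[of xs] by simp
  next
    case (Suc k)
    note x = prod[OF Suc.prems(3)]
    have Ak: "A [^]\<^bsub>M\<^esub> k \<in> carrier M" using A by simp
    have "(A [^]\<^bsub>M\<^esub> Suc k) $$ (i, j) \<otimes> foldr (\<otimes>) xs \<one> =
        (\<Oplus>l\<in>{..<n}. (A [^]\<^bsub>M\<^esub> k) $$ (i, l) \<otimes> A $$ (l, j)) \<otimes> foldr (\<otimes>) xs \<one>"
      using Suc.prems by (simp add: mult_entry)
    also have "\<dots> = (\<Oplus>l\<in>{..<n}. (A [^]\<^bsub>M\<^esub> k) $$ (i, l) \<otimes> A $$ (l, j) \<otimes> foldr (\<otimes>) xs \<one>)"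
      using Suc.prems x A Ak by (intro finsum_ldistr) auto
    also have "\<dots> = (\<Oplus>l\<in>{..<n}. \<zero>)"
    proof (intro finsum_cong' refl)
      fix l assume l: "l \<in> {..<n}"
      have "(A [^]\<^bsub>M\<^esub> k) $$ (i, l) \<otimes> foldr (\<otimes>) (A $$ (l, j) # xs) \<one> = \<zero>"
        using Suc.prems l by (intro Suc.IH) (auto simp: F_def)
      then show "(A [^]\<^bsub>M\<^esub> k) $$ (i, l) \<otimes> A $$ (l, j) \<otimes> foldr (\<otimes>) xs \<one> = \<zero>"
        using Suc.prems l x A Ak by (simp add: m_assoc)
    qed auto
    finally show ?case by simp
  qed
  from this[of _ _ "[]" L] have "(A [^]\<^bsub>M\<^esub> L) $$ (i, j) = \<zero>" if "i < n" "j < n" for i j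
    using that A by simp
  then have "A [^]\<^bsub>M\<^esub> L = \<zero>\<^bsub>M\<^esub>" using A by (intro M_eqI) auto
  then show ?thesis ..
qed

section \<open>Maximal left ideals given by columns\<close>

definition column_ideal :: "'a set \<Rightarrow> nat \<Rightarrow> 'a mat set" where
  "column_ideal S j = {A \<in> carrier M. \<forall>i<n. A $$ (i, j) \<in> S}"

text \<open>Modulo \<open>S\<close> column vectors form a simple module. An entry of column
  \<open>j\<close> outside \<open>S\<close> can be moved to position \<open>(j, j)\<close> and
  scaled to \<open>1\<close> modulo \<open>S\<close>, so any larger left ideal contains the
  identity.\<close>

lemma column_ideal_maximal:
  assumes S: "ideal S R" and j: "j < n" and one: "\<one> \<notin> S"
    and inv: "\<And>a. a \<in> carrier R \<Longrightarrow> a \<notin> S \<Longrightarrow> \<exists>b\<in>carrier R. b \<otimes> a \<ominus> \<one> \<in> S"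
  shows "maximal_left_ideal (column_ideal S j) M"
proof -
  interpret S: ideal S R by fact
  have add: "additive_subgroup (column_ideal S j) M"
    using j by (intro M_additive_subgroupI) (auto simp: column_ideal_def)
  have "left_ideal (column_ideal S j) M"
    unfolding left_ideal_def
  proof (intro conjI ballI add)
    fix A B assume "A \<in> carrier M" "B \<in> column_ideal S j"
    then show "A \<otimes>\<^bsub>M\<^esub> B \<in> column_ideal S j"
      using j unfolding column_ideal_def
      by (auto simp: mult_entry S.I_l_closed intro!: additive_subgroup_finsum_closed S.is_additive_subgroup)
  qed
  moreover have "column_ideal S j \<noteq> carrier M"
  proof
    assume "column_ideal S j = carrier M"
    then have "\<one>\<^bsub>M\<^esub> \<in> column_ideal S j" by simp
    then have "\<one>\<^bsub>M\<^esub> $$ (j, j) \<in> S" using j unfolding column_ideal_def by blast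
    then show False using j one by simp
  qed
  moreover have "K = carrier M"
    if K: "left_ideal K M" "column_ideal S j \<subseteq> K" "K \<noteq> column_ideal S j" for K
  proof -
    interpret K: additive_subgroup K M using K(1) by (simp add: left_ideal_def)
    have Kl: "A \<otimes>\<^bsub>M\<^esub> B \<in> K" if "A \<in> carrier M" "B \<in> K" for A B
      using K(1) that by (simp add: left_ideal_def)
    obtain B where B: "B \<in> K" "B \<notin> column_ideal S j" using K by blast
    then have BM: "B \<in> carrier M" using K.a_subset by blast
    obtain r where r: "r < n" "B $$ (r, j) \<notin> S" using B BM by (auto simp: column_ideal_def)
    obtain b where b: "b \<in> carrier R" "b \<otimes> B $$ (r, j) \<ominus> \<one> \<in> S"
      using inv[of "B $$ (r, j)"] r j BM by auto
    define C where "C = E j r b \<otimes>\<^bsub>M\<^esub> B"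
    have C: "C \<in> carrier M" "C \<in> K" using b BM B(1) Kl[of "E j r b" B] by (auto simp: C_def)
    \<comment> \<open>Only column \<open>j\<close> matters: there \<open>C\<close> agrees with the
      identity modulo \<open>S\<close>.\<close>
    have "C \<ominus>\<^bsub>M\<^esub> \<one>\<^bsub>M\<^esub> \<in> column_ideal S j"
      unfolding column_ideal_def
    proof (intro CollectI conjI allI impI)
      fix i assume i: "i < n"
      have "C $$ (i, j) = (if i = j then b \<otimes> B $$ (r, j) else \<zero>)"
        using b BM i j r by (simp add: C_def E_mult_entry)
      then show "(C \<ominus>\<^bsub>M\<^esub> \<one>\<^bsub>M\<^esub>) $$ (i, j) \<in> S"
        using b(2) C i j by (cases "i = j") (simp_all add: a_minus_def)
    qed (use C in simp)
    then have "C \<ominus>\<^bsub>M\<^esub> (C \<ominus>\<^bsub>M\<^esub> \<one>\<^bsub>M\<^esub>) \<in> K"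
      using C K(2) unfolding a_minus_def by blast
    also have "C \<ominus>\<^bsub>M\<^esub> (C \<ominus>\<^bsub>M\<^esub> \<one>\<^bsub>M\<^esub>) = \<one>\<^bsub>M\<^esub>"
      using C(1) by (simp add: a_minus_def M.minus_add M.r_neg2)
    finally have "\<one>\<^bsub>M\<^esub> \<in> K" .
    then show ?thesis using Kl[of _ "\<one>\<^bsub>M\<^esub>"] K.a_subset by auto
  qed
  ultimately show ?thesis unfolding maximal_left_ideal_def by blast
qed

end

locale nil_ideal_t_fine_matrix_ring = nil_ideal_t_fine_ring R + matrix_ring_over R n
  for R (structure) and n +
  assumes N_locally_nilpotent: "locally_nilpotent (nilpotents R) R"
    and n_pos: "n \<ge> 1"
begin

abbreviation "Q \<equiv> R Quot N"
abbreviation "K \<equiv> mats_over N"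

sublocale K: ideal K M
  by (rule mats_over_ideal) (rule nil_ideal)

sublocale h: ring_hom_ring R Q "(+>) N"
  by (rule N.rcos_ring_hom_ring)

lemma K_nil: "A \<in> K \<Longrightarrow> \<exists>k::nat. A [^]\<^bsub>M\<^esub> k = \<zero>\<^bsub>M\<^esub>"
  by (rule mats_over_locally_nilpotent[OF N_locally_nilpotent N.a_subset])

lemma Q_obtain:
  assumes "a \<in> carrier Q"
  obtains r where "r \<in> carrier R" "a = N +> r"
proof -
  have "a \<in> a_rcosets N" using assms by (simp only: FactRing_def partial_object.simps)
  then show thesis using that unfolding A_RCOSETS_def' by blast
qed

lemma inverse_mod_N:
  assumes "a \<in> carrier R" "a \<notin> N"
  shows "\<exists>b\<in>carrier R. b \<otimes> a \<ominus> \<one> \<in> N"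
proof -
  obtain m :: nat where m: "m \<ge> 1" "a [^] m \<ominus> \<one> \<in> N"
    using torsion_mod_N assms unfolding J_eq_N by metis
  obtain l where l: "m = Suc l" using m(1) by (cases m) auto
  show ?thesis using m(2) assms(1) unfolding l by (intro bexI[of _ "a [^] l"]) auto
qed

text \<open>The ideal \<open>K\<close> is nil, hence inside the radical. Conversely the radical lies
  in every column ideal of \<open>N\<close>, and these intersect in \<open>K\<close>.\<close>

lemma jacobson_radical_matrix: "jacobson_radical M = K"
proof
  show "K \<subseteq> jacobson_radical M"
    by (rule M.nil_ideal_subset_jacobson_radical[OF K.is_ideal K_nil])
  show "jacobson_radical M \<subseteq> K"
  proof
    fix A assume A: "A \<in> jacobson_radical M"
    have "A \<in> column_ideal N j" if "j < n" for j
      using A column_ideal_maximal[OF nil_ideal that one_notin_N inverse_mod_N]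
      unfolding jacobson_radical_def by blast
    moreover have "A \<in> carrier M" using A unfolding jacobson_radical_def by blast
    ultimately show "A \<in> K" unfolding mats_over_def column_ideal_def by blast
  qed
qed

lemma one_notin_K: "\<one>\<^bsub>M\<^esub> \<notin> K"
proof
  assume "\<one>\<^bsub>M\<^esub> \<in> K"
  \<comment> \<open>The entry \<open>(0, 0)\<close> exists because \<open>n \<ge> 1\<close>.\<close>
  then have "\<one>\<^bsub>M\<^esub> $$ (0, 0) \<in> N" using n_pos by (intro mats_overD) auto
  then show False using n_pos one_notin_N by simp
qed

section \<open>Reduction modulo \<open>N\<close> and lifting of decompositions\<close>

definition reduce :: "'a mat \<Rightarrow> 'a set mat" where
  "reduce A = mat n n (\<lambda>(i, j). N +> A $$ (i, j))"

lemma reduce_entry: "i < n \<Longrightarrow> j < n \<Longrightarrow> reduce A $$ (i, j) = N +> A $$ (i, j)"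
  by (simp add: reduce_def)

sublocale MQ: matrix_ring_over Q n
  by (intro matrix_ring_over.intro N.quotient_is_ring)

lemma reduce_hom: "ring_hom_ring M (matrix_ring n Q) reduce"
proof (rule ring_hom_ringI)
  show closed: "reduce A \<in> carrier (matrix_ring n Q)" if "A \<in> carrier M" for A
    unfolding reduce_def using that by (intro MQ.mat_closed) auto
  show "reduce (A \<otimes>\<^bsub>M\<^esub> B) = reduce A \<otimes>\<^bsub>matrix_ring n Q\<^esub> reduce B"
    if "A \<in> carrier M" "B \<in> carrier M" for A B
  proof (rule MQ.M_eqI)
    fix i j assume ij: "i < n" "j < n"
    have "N +> (\<Oplus>k\<in>{..<n}. A $$ (i, k) \<otimes> B $$ (k, j)) =
        (\<Oplus>\<^bsub>Q\<^esub>k\<in>{..<n}. N +> (A $$ (i, k) \<otimes> B $$ (k, j)))"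
      using ij that by (subst h.hom_finsum) (auto simp: comp_def)
    also have "\<dots> = (\<Oplus>\<^bsub>Q\<^esub>k\<in>{..<n}. reduce A $$ (i, k) \<otimes>\<^bsub>Q\<^esub> reduce B $$ (k, j))"
      using ij that by (intro h.S.finsum_cong') (auto simp: reduce_entry)
    finally show "reduce (A \<otimes>\<^bsub>M\<^esub> B) $$ (i, j) = (reduce A \<otimes>\<^bsub>matrix_ring n Q\<^esub> reduce B) $$ (i, j)"
      using ij by (simp add: reduce_entry mult_entry MQ.mult_entry)
  qed (use that closed in auto)
  show "reduce (A \<oplus>\<^bsub>M\<^esub> B) = reduce A \<oplus>\<^bsub>matrix_ring n Q\<^esub> reduce B"
    if "A \<in> carrier M" "B \<in> carrier M" for A B
    using that closed by (intro MQ.M_eqI) (auto simp: reduce_entry)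
  show "reduce \<one>\<^bsub>M\<^esub> = \<one>\<^bsub>matrix_ring n Q\<^esub>"
    using closed by (intro MQ.M_eqI) (auto simp: reduce_entry)
qed (rule M.ring_axioms MQ.M.ring_axioms)+

sublocale H: ring_hom_ring M "matrix_ring n Q" reduce
  by (rule reduce_hom)

lemma reduce_eq_zero_iff:
  assumes "A \<in> carrier M"
  shows "reduce A = \<zero>\<^bsub>matrix_ring n Q\<^esub> \<longleftrightarrow> A \<in> K"
proof
  assume z: "reduce A = \<zero>\<^bsub>matrix_ring n Q\<^esub>"
  have "A $$ (i, j) \<in> N" if "i < n" "j < n" for i j
    using arg_cong[OF z, of "\<lambda>B. B $$ (i, j)"] that assms coset_eq_zero_iff[of "A $$ (i, j)"]
    by (simp add: reduce_entry)
  then show "A \<in> K" using assms unfolding mats_over_def by blast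
next
  assume "A \<in> K"
  then have "N +> A $$ (i, j) = \<zero>\<^bsub>Q\<^esub>" if "i < n" "j < n" for i j
    using that assms coset_eq_zero_iff[of "A $$ (i, j)"] mats_overD[of A N i j] by blast
  then show "reduce A = \<zero>\<^bsub>matrix_ring n Q\<^esub>"
    using H.hom_closed[OF assms] by (intro MQ.M_eqI) (auto simp: reduce_entry)
qed

lemma reduce_surj:
  assumes B: "B \<in> carrier (matrix_ring n Q)"
  obtains A where "A \<in> carrier M" "reduce A = B"
proof -
  have "\<exists>r. r \<in> carrier R \<and> N +> r = B $$ (i, j)" if "i < n" "j < n" for i j
    using Q_obtain[OF MQ.entry_closed[OF B that]] by metis
  then obtain f where f: "\<And>i j. i < n \<Longrightarrow> j < n \<Longrightarrow> f i j \<in> carrier R \<and> N +> f i j = B $$ (i, j)"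
    by metis
  define A where "A = mat n n (\<lambda>(i, j). f i j)"
  have A: "A \<in> carrier M" unfolding A_def using f by (intro mat_closed) simp
  have "reduce A = B"
    using f by (intro MQ.M_eqI H.hom_closed A B) (simp add: reduce_entry A_def)
  with A show thesis by (rule that)
qed

lemma Q_torsion:
  assumes "a \<in> carrier Q" "a \<noteq> \<zero>\<^bsub>Q\<^esub>"
  shows "\<exists>m\<ge>1::nat. a [^]\<^bsub>Q\<^esub> m = \<one>\<^bsub>Q\<^esub>"
proof -
  obtain r where r: "r \<in> carrier R" "a = N +> r" using Q_obtain assms(1) by metis
  then have "r \<notin> J" using assms(2) coset_eq_zero_iff J_eq_N by blast
  then obtain m :: nat where m: "m \<ge> 1" "r [^] m \<ominus> \<one> \<in> N" using torsion_mod_N r(1) by metis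
  have "r [^] m = (r [^] m \<ominus> \<one>) \<oplus> \<one>" using r(1) by (simp add: a_minus_def a_assoc l_neg)
  then have "N +> r [^] m = (N +> (r [^] m \<ominus> \<one>)) \<oplus>\<^bsub>Q\<^esub> \<one>\<^bsub>Q\<^esub>"
    using r(1) h.hom_add[of "r [^] m \<ominus> \<one>" \<one>] by simp
  also have "\<dots> = \<one>\<^bsub>Q\<^esub>"
    using m(2) r(1) coset_eq_zero_iff[of "r [^] m \<ominus> \<one>"] by simp
  finally have "a [^]\<^bsub>Q\<^esub> m = \<one>\<^bsub>Q\<^esub>" using r by (simp add: h.hom_nat_pow)
  then show ?thesis using m(1) by blast
qed

text \<open>Any lift \<open>U\<close> of the torsion unit found over \<open>Q\<close> works, with
  \<open>X = A - U\<close>. Since the kernel \<open>K\<close> is nil, nilpotency lifts directly;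
  torsion lifts through unipotents in positive characteristic.\<close>

lemma matrix_decomposition:
  assumes A: "A \<in> carrier M" "A \<notin> K"
  obtains U X where "U \<in> torsion_units M" "X \<in> nilpotents M" "A = U \<oplus>\<^bsub>M\<^esub> X"
proof -
  obtain c where c: "c \<ge> 1" "int_in c = \<zero>" using char_pos by blast
  interpret D: torsion_division_matrix_ring Q n c
  proof (unfold_locales)
    show "[c] \<cdot>\<^bsub>Q\<^esub> \<one>\<^bsub>Q\<^esub> = \<zero>\<^bsub>Q\<^esub>" unfolding coset_int_in[symmetric] c(2) by simp
    show "\<one>\<^bsub>Q\<^esub> \<noteq> \<zero>\<^bsub>Q\<^esub>" using coset_eq_zero_iff[OF one_closed] one_notin_N by simp
  qed (use Q_torsion c in auto)
  have hA: "reduce A \<in> carrier (matrix_ring n Q)" using A by simp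
  have "fine_in (matrix_ring n Q) (mat_idem n Q {..<n}) (reduce A)"
    using A hA reduce_eq_zero_iff
    by (intro D.fine_corner) (auto simp: MQ.corner_def MQ.idem_full)
  then obtain U' X' m k where UX: "U' \<in> carrier (matrix_ring n Q)" "X' \<in> carrier (matrix_ring n Q)"
    "reduce A = U' \<oplus>\<^bsub>matrix_ring n Q\<^esub> X'"
    "m \<ge> (1::nat)" "U' [^]\<^bsub>matrix_ring n Q\<^esub> m = \<one>\<^bsub>matrix_ring n Q\<^esub>"
    "X' [^]\<^bsub>matrix_ring n Q\<^esub> (k::nat) = \<zero>\<^bsub>matrix_ring n Q\<^esub>"
    unfolding fine_in_def MQ.idem_full by metis
  obtain U where U: "U \<in> carrier M" "reduce U = U'" using reduce_surj UX(1) by metis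
  define X where "X = A \<ominus>\<^bsub>M\<^esub> U"
  have X: "X \<in> carrier M" using A U by (simp add: X_def)
  have "reduce X = X'"
    using A U UX(1-3) by (simp add: X_def a_minus_def MQ.M.a_comm[of U'] MQ.M.a_assoc MQ.M.r_neg)
  then have "reduce (X [^]\<^bsub>M\<^esub> k) = \<zero>\<^bsub>matrix_ring n Q\<^esub>" using X UX by (simp add: H.hom_nat_pow)
  then have "X [^]\<^bsub>M\<^esub> k \<in> K" using X reduce_eq_zero_iff by simp
  then obtain k' :: nat where "(X [^]\<^bsub>M\<^esub> k) [^]\<^bsub>M\<^esub> k' = \<zero>\<^bsub>M\<^esub>" using K_nil by blast
  then have "X [^]\<^bsub>M\<^esub> (k * k') = \<zero>\<^bsub>M\<^esub>" using X by (simp only: M.nat_pow_pow)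
  then have Xnil: "X \<in> nilpotents M" unfolding nilpotents_def using X by blast
  \<comment> \<open>This error term lies in the nil ideal \<open>K\<close>, so
    \<open>U^m = 1 + B\<close> is unipotent and therefore torsion.\<close>
  define B where "B = U [^]\<^bsub>M\<^esub> m \<ominus>\<^bsub>M\<^esub> \<one>\<^bsub>M\<^esub>"
  have B: "B \<in> carrier M" using U by (simp add: B_def)
  have "reduce B = \<zero>\<^bsub>matrix_ring n Q\<^esub>"
    using U UX(5) by (simp add: B_def a_minus_def H.hom_nat_pow MQ.M.r_neg)
  then have "B \<in> K" using B reduce_eq_zero_iff by simp
  then obtain l :: nat where "B [^]\<^bsub>M\<^esub> l = \<zero>\<^bsub>M\<^esub>" using K_nil by blast
  then obtain t :: nat where t: "t \<ge> 1" "(\<one>\<^bsub>M\<^esub> \<oplus>\<^bsub>M\<^esub> B) [^]\<^bsub>M\<^esub> t = \<one>\<^bsub>M\<^esub>"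
    using M.one_plus_nilpotent_torsion[OF add_pow_one_M[OF c(2)] c(1) B] by blast
  have "\<one>\<^bsub>M\<^esub> \<oplus>\<^bsub>M\<^esub> B = U [^]\<^bsub>M\<^esub> m"
    using U by (simp add: B_def a_minus_def M.a_comm[of _ "\<ominus>\<^bsub>M\<^esub> \<one>\<^bsub>M\<^esub>"] M.r_neg2)
  then have Ut: "U [^]\<^bsub>M\<^esub> (m * t) = \<one>\<^bsub>M\<^esub>" using t(2) U by (simp only: M.nat_pow_pow)
  obtain s where s: "m * t = Suc s" using t(1) UX(4) by (cases "m * t") auto
  have "U [^]\<^bsub>M\<^esub> s \<otimes>\<^bsub>M\<^esub> U = \<one>\<^bsub>M\<^esub>" "U \<otimes>\<^bsub>M\<^esub> U [^]\<^bsub>M\<^esub> s = \<one>\<^bsub>M\<^esub>"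
    using Ut U unfolding s by (simp_all only: M.nat_pow_Suc2[symmetric] M.nat_pow_Suc)
  then have "U \<in> Units M" unfolding Units_def using U by blast
  then have "U \<in> torsion_units M"
    unfolding torsion_units_def using Ut s by (intro CollectI conjI exI[of _ "m * t"]) auto
  moreover have "A = U \<oplus>\<^bsub>M\<^esub> X"
    using A U by (simp add: X_def a_minus_def M.a_comm[of A] M.r_neg2)
  ultimately show thesis using Xnil that by blast
qed

text \<open>Otherwise \<open>X\<close> is congruent to \<open>-U\<close> modulo \<open>K\<close>.
  Taking the power that kills \<open>X\<close> puts the unit \<open>(-U)^k\<close> into
  \<open>K\<close>, and with it \<open>1\<close>.\<close>

lemma torsion_plus_nilpotent_notin_K:
  assumes U: "U \<in> torsion_units M" and X: "X \<in> nilpotents M"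
  shows "U \<oplus>\<^bsub>M\<^esub> X \<notin> K"
proof
  assume UX: "U \<oplus>\<^bsub>M\<^esub> X \<in> K"
  have UM: "U \<in> Units M" "U \<in> carrier M" using U M.Units_closed unfolding torsion_units_def by blast+
  obtain k :: nat where k: "X \<in> carrier M" "X [^]\<^bsub>M\<^esub> k = \<zero>\<^bsub>M\<^esub>"
    using X unfolding nilpotents_def by blast
  have "X \<ominus>\<^bsub>M\<^esub> (\<ominus>\<^bsub>M\<^esub> U) \<in> K"
    using UX UM k by (simp add: a_minus_def M.a_comm)
  then have 1: "X [^]\<^bsub>M\<^esub> k \<ominus>\<^bsub>M\<^esub> (\<ominus>\<^bsub>M\<^esub> U) [^]\<^bsub>M\<^esub> k \<in> K"
    using UM k by (intro M.ideal_pow_minus[OF K.is_ideal]) auto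
  define P where "P = (\<ominus>\<^bsub>M\<^esub> U) [^]\<^bsub>M\<^esub> k"
  have P: "P \<in> Units M"
  proof -
    have "(\<ominus>\<^bsub>M\<^esub> \<one>\<^bsub>M\<^esub>) \<otimes>\<^bsub>M\<^esub> U \<in> Units M" using UM by (intro M.Units_m_closed M.Units_minus_one_closed)
    then have "\<ominus>\<^bsub>M\<^esub> U \<in> Units M" using UM by (simp add: M.l_minus)
    then show ?thesis unfolding P_def by (induction k) auto
  qed
  have PM: "P \<in> carrier M" using P by (rule M.Units_closed)
  have "\<ominus>\<^bsub>M\<^esub> P \<in> K"
    using 1 k(2) PM unfolding P_def[symmetric] by (simp add: a_minus_def)
  then have "\<ominus>\<^bsub>M\<^esub> (\<ominus>\<^bsub>M\<^esub> P) \<in> K" by (rule K.a_inv_closed)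
  then have "P \<in> K" using PM by simp
  then have "inv\<^bsub>M\<^esub> P \<otimes>\<^bsub>M\<^esub> P \<in> K" using P by (intro K.I_l_closed) auto
  then show False using P one_notin_K by simp
qed

lemma generalized_t_fine_matrix_ring: "generalized_t_fine M"
  unfolding generalized_t_fine_def jacobson_radical_matrix
proof
  show "carrier M - K \<subseteq> torsion_units M <+>\<^bsub>M\<^esub> nilpotents M"
  proof
    fix A assume "A \<in> carrier M - K"
    then obtain U X where "U \<in> torsion_units M" "X \<in> nilpotents M" "A = U \<oplus>\<^bsub>M\<^esub> X"
      using matrix_decomposition[of A] by (metis DiffD1 DiffD2)
    then show "A \<in> torsion_units M <+>\<^bsub>M\<^esub> nilpotents M" unfolding set_add_def' by blast
  qed
  show "torsion_units M <+>\<^bsub>M\<^esub> nilpotents M \<subseteq> carrier M - K"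
  proof
    fix A assume "A \<in> torsion_units M <+>\<^bsub>M\<^esub> nilpotents M"
    then obtain U X where UX: "U \<in> torsion_units M" "X \<in> nilpotents M" "A = U \<oplus>\<^bsub>M\<^esub> X"
      unfolding set_add_def' by blast
    then have "U \<in> carrier M" "X \<in> carrier M"
      using M.Units_closed unfolding torsion_units_def nilpotents_def by blast+
    then show "A \<in> carrier M - K" using UX torsion_plus_nilpotent_notin_K by simp
  qed
qed

end

theorem theorem2p16:
  fixes R :: "('a, 'm) ring_scheme" and n :: nat
  assumes "ring R"
    and "weakly_2_primal R"
    and "generalized_t_fine R"
    and "n \<ge> 1"
  shows "generalized_t_fine (matrix_ring n R)"
proof -
  \<comment> \<open>The Levitzki condition supplies the ideal property for the radical of
    \<open>R\<close> and local nilpotence for the nil ideal of matrices.\<close>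
  have "levitzki_radical (nilpotents R) R" using assms(2) by (simp only: weakly_2_primal_def)
  then have "ideal (nilpotents R) R" "locally_nilpotent (nilpotents R) R"
    by (simp_all only: levitzki_radical_def)
  then have "nil_ideal_t_fine_matrix_ring R n"
    using assms(1,3,4)
    by (intro nil_ideal_t_fine_matrix_ring.intro nil_ideal_t_fine_ring.intro
        nil_ideal_t_fine_ring_axioms.intro matrix_ring_over.intro
        nil_ideal_t_fine_matrix_ring_axioms.intro)
  then show ?thesis by (rule nil_ideal_t_fine_matrix_ring.generalized_t_fine_matrix_ring)
qed

end
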